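(* For $n\ge1$ and $k\ge 0$, let $\Gamma_{n,k}$ be the set of permutations $\sigma\in\mathfrak S_n$ with no double descents, no final descent, and with $\mathrm{des}(\sigma)=k$, and let $$\gamma_{n,k}(q):=\sum_{\sigma\in\Gamma_{n,k}}q^{\mathrm{inv}(\sigma)}\quad\Bigl(=\sum_{\sigma\in\Gamma_{n,k}}q^{\mathrm{maj}(\sigma^{-1})}\Bigr).$$ Then for all $n\ge1$, $$A_n(q,t)=\sum_{k=0}^{\lfloor\frac{n-1}{2}\rfloor}\gamma_{n,k}(q)\,t^k(1+t)^{n-1-2k}.$$ Consequently the $q$-Eulerian polynomials $A_n(q,t)$ are $q$-$\gamma$-positive.
   Context: For $\sigma\in\mathfrak S_n$: $\mathrm{DES}(\sigma)=\{i\in[n-1]:\sigma(i)>\sigma(i+1)\}$, $\mathrm{des}(\sigma)=|\mathrm{DES}(\sigma)|$, $\mathrm{maj}(\sigma)=\sum_{i\in\mathrm{DES}(\sigma)}i$, $\mathrm{exc}(\sigma)=|\{i\in[n-1]:\sigma(i)>i\}|$, $\mathrm{inv}(\sigma)=|\{(i,j):1\le i<j\le n,\ \sigma(i)>\sigma(j)\}|$. A double descent of $\sigma$ is an $i\in[n-2]$ with $\sigma(i)>\sigma(i+1)>\sigma(i+2)$; $\sigma$ has a final descent if $n\ge2$ and $\sigma(n-1)>\sigma(n)$. The $q$-Eulerian polynomials are $A_n(q,t):=\sum_{\sigma\in\mathfrak S_n}q^{\mathrm{maj}(\sigma)-\mathrm{exc}(\sigma)}t^{\mathrm{exc}(\sigma)}$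 for $n\ge1$. A polynomial in $\mathbb R[q]$ is $q$-positive if its coefficients are nonnegative. A polynomial $A(t)\in\mathbb R[q][t]$ is $q$-$\gamma$-positive if for some $d$ there exist $q$-positive $\gamma_0,\dots,\gamma_{\lfloor d/2\rfloor}\in\mathbb R[q]$ with $A(t)=\sum_{k=0}^{\lfloor d/2\rfloor}\gamma_kt^k(1+t)^{d-2k}$. *)

theory Defs
  imports
    "HOL-Combinatorics.Permutations"
    "HOL-Computational_Algebra.Polynomial"
begin

text \<open>
  The symmetric group on [n] is \<open>{\<sigma>. \<sigma> permutes {1..n}}\<close>, in one-line notation
  \<open>\<sigma> 1, \<dots>, \<sigma> n\<close>. As the functions are total on \<open>nat\<close>, every statistic takes \<open>n\<close> as
  an argument. The intervals [n-1] and [n-2] become \<open>{1..n-1}\<close> and \<open>{1..n-2}\<close>; where the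
  subtraction truncates, both readings are empty.
\<close>

definition DES :: "nat \<Rightarrow> (nat \<Rightarrow> nat) \<Rightarrow> nat set" where
  "DES n \<sigma> = {i \<in> {1..n-1}. \<sigma> i > \<sigma> (i + 1)}"

definition des :: "nat \<Rightarrow> (nat \<Rightarrow> nat) \<Rightarrow> nat" where
  "des n \<sigma> = card (DES n \<sigma>)"

definition maj :: "nat \<Rightarrow> (nat \<Rightarrow> nat) \<Rightarrow> nat" where
  "maj n \<sigma> = (\<Sum>i\<in>DES n \<sigma>. i)"

definition exc :: "nat \<Rightarrow> (nat \<Rightarrow> nat) \<Rightarrow> nat" where
  "exc n \<sigma> = card {i \<in> {1..n-1}. \<sigma> i > i}"

text \<open>The inversion number; the name \<open>inv\<close> is taken by the inverse function.\<close>

definition inversion_number :: "nat \<Rightarrow> (nat \<Rightarrow> nat) \<Rightarrow> nat" where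
  "inversion_number n \<sigma> = card {(i, j). 1 \<le> i \<and> i < j \<and> j \<le> n \<and> \<sigma> i > \<sigma> j}"

definition double_descent :: "nat \<Rightarrow> (nat \<Rightarrow> nat) \<Rightarrow> nat \<Rightarrow> bool" where
  "double_descent n \<sigma> i \<longleftrightarrow> i \<in> {1..n-2} \<and> \<sigma> i > \<sigma> (i + 1) \<and> \<sigma> (i + 1) > \<sigma> (i + 2)"

definition has_final_descent :: "nat \<Rightarrow> (nat \<Rightarrow> nat) \<Rightarrow> bool" where
  "has_final_descent n \<sigma> \<longleftrightarrow> n \<ge> 2 \<and> \<sigma> (n - 1) > \<sigma> n"

text \<open>The exponent \<open>maj - exc\<close> in the q-Eulerian polynomial never truncates.\<close>

lemma exc_le_maj:
  assumes "\<sigma> permutes {1..n}"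
  shows "exc n \<sigma> \<le> maj n \<sigma>"
proof -
  have fin: "finite (DES n \<sigma>)" by (simp add: DES_def)
  have below: "\<exists>d\<in>DES n \<sigma>. i \<le> d" if i: "i \<in> {1..n-1}" "\<sigma> i > i" for i
  proof (rule ccontr)
    assume no: "\<not> (\<exists>d\<in>DES n \<sigma>. i \<le> d)"
    have step: "\<sigma> j < \<sigma> (Suc j)" if "i \<le> j" "j < n" for j
    proof -
      have "j \<notin> DES n \<sigma>" using no that by auto
      then have "\<sigma> j \<le> \<sigma> (Suc j)" using that i by (auto simp: DES_def)
      moreover have "\<sigma> j \<noteq> \<sigma> (Suc j)"
        by (simp add: inj_eq[OF permutes_inj[OF assms]])
      ultimately show ?thesis by simp
    qed
    have grow: "\<sigma> (i + m) > i + m" if "i + m \<le> n" for m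
      using that
    proof (induction m)
      case 0
      then show ?case using i by simp
    next
      case (Suc m)
      then show ?case using step[of "i + m"] by simp
    qed
    have "i \<le> n" using i by auto
    then have "\<sigma> n > n" using grow[of "n - i"] by simp
    moreover have "\<sigma> n \<in> {1..n}"
      using permutes_in_image[OF assms, of n] i by auto
    ultimately show False by simp
  qed
  show ?thesis
  proof (cases "DES n \<sigma> = {}")
    case True
    then have "{i \<in> {1..n-1}. \<sigma> i > i} = {}" using below by blast
    then show ?thesis unfolding exc_def by (simp only: card.empty le0)
  next
    case False
    have "{i \<in> {1..n-1}. \<sigma> i > i} \<subseteq> {1..Max (DES n \<sigma>)}"
    proof
      fix i assume "i \<in> {i \<in> {1..n-1}. \<sigma> i > i}"
      then have i: "i \<in> {1..n-1}" "\<sigma> i > i" by auto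
      from below[OF this] obtain d where "d \<in> DES n \<sigma>" "i \<le> d" by blast
      then have "i \<le> Max (DES n \<sigma>)" using Max_ge[OF fin, of d] by linarith
      then show "i \<in> {1..Max (DES n \<sigma>)}" using i by simp
    qed
    then have "exc n \<sigma> \<le> Max (DES n \<sigma>)"
      unfolding exc_def using card_mono[OF finite_atLeastAtMost, of _ 1 "Max (DES n \<sigma>)"]
      by (metis card_atLeastAtMost diff_Suc_1)
    also have "\<dots> \<le> maj n \<sigma>"
      unfolding maj_def by (rule member_le_sum) (use Max_in[OF fin False] fin in simp_all)
    finally show ?thesis .
  qed
qed

text \<open>
  \<open>\<real>[q][t]\<close> is \<open>real poly poly\<close>: the coefficients are polynomials in \<open>q\<close> and the outer
  variable is \<open>t\<close>, so \<open>q\<^sup>a t\<^sup>b\<close> is \<open>monom (monom 1 a) b\<close> and \<open>1 + t\<close> is \<open>[:1, 1:]\<close>.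
\<close>

definition q_eulerian :: "nat \<Rightarrow> real poly poly" where
  "q_eulerian n =
     (\<Sum>\<sigma> | \<sigma> permutes {1..n}. monom (monom 1 (maj n \<sigma> - exc n \<sigma>)) (exc n \<sigma>))"

definition Gamma_set :: "nat \<Rightarrow> nat \<Rightarrow> (nat \<Rightarrow> nat) set" where
  "Gamma_set n k =
     {\<sigma>. \<sigma> permutes {1..n} \<and> (\<forall>i. \<not> double_descent n \<sigma> i) \<and>
          \<not> has_final_descent n \<sigma> \<and> des n \<sigma> = k}"

definition gamma_poly :: "nat \<Rightarrow> nat \<Rightarrow> real poly" where
  "gamma_poly n k = (\<Sum>\<sigma>\<in>Gamma_set n k. monom 1 (inversion_number n \<sigma>))"

definition q_positive :: "real poly \<Rightarrow> bool" where
  "q_positive p \<longleftrightarrow> (\<forall>i. coeff p i \<ge> 0)"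

definition q_gamma_positive :: "real poly poly \<Rightarrow> bool" where
  "q_gamma_positive A \<longleftrightarrow>
     (\<exists>d (\<gamma> :: nat \<Rightarrow> real poly).
        (\<forall>k \<le> d div 2. q_positive (\<gamma> k)) \<and>
        A = (\<Sum>k \<le> d div 2. smult (\<gamma> k) (monom 1 k * [:1, 1:] ^ (d - 2 * k))))"

end

theory Submission
  imports Defs "HOL-Combinatorics.Multiset_Permutations" "HOL-Computational_Algebra.Formal_Power_Series"
begin

text \<open>
  Everything is evaluated at real numbers \<open>0 < q < 1\<close> and \<open>t > 0\<close>; polynomials that agree there
  are equal. Write \<open>(q)\<^sub>n\<close> for \<open>(1 - q) \<dots> (1 - q\<^sup>n)\<close>.

  Permutations whose descent set is contained in \<open>S\<close> correspond to the rearrangements of a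
  multiset (label each value of the inverse by its block), under which \<open>inv\<close> and the major index
  of the inverse become \<open>inv\<close> and \<open>maj\<close> of words. Both have the same q-multinomial generating
  function, and inclusion-exclusion over \<open>S\<close> gives the equality for each \<open>\<Gamma>\<close>.

  Splitting the permutations counted by \<open>\<gamma>\<close> at the letter 1 shows that
  \<open>a\<^sub>n = (1 + t)\<^sup>n\<^sup>-\<^sup>1 \<Sum>\<^sub>k \<gamma>\<^sub>n\<^sub>,\<^sub>k (t / (1 + t)\<^sup>2)\<^sup>k\<close> satisfies a quadratic recursion, that is, a
  functional equation linking \<open>R(z) = \<Sum> a\<^sub>n z\<^sup>n / (q)\<^sub>n\<close> and \<open>R(qz)\<close>.

  On the Eulerian side \<open>maj - exc\<close> is the sum of the descent positions when excedance values are
  ranked below all other values. For injections from \<open>[n]\<close> to \<open>[n] \<union> V\<close> with \<open>V\<close> a set of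
  \<open>b\<close> values larger than \<open>n\<close>, removing strictly decreasing tails gives a recursion in \<open>n\<close> for
  all \<open>b\<close> at once, and by the functional equation it is solved by the coefficients of
  \<open>R (1 - t + t R)\<^sup>b\<close>. The case \<open>b = 0\<close> is the theorem.
\<close>

text \<open>Both uses of decreasing tails end alike: the empty tail reproduces the unknown, so it
  appears with the factor 1 - q^n, nonzero for 0 < q < 1 and n > 0. A solution of such a recursion
  is therefore unique, and it is enough that the expected answer satisfies it too.

  The obstacle on the Eulerian side is that being an excedance depends on the position. Once the
  positions after m are cut off, however, each of the values m+1, ..., n exceeds every remaining
  position, so such values are interchangeable and only their number matters.

  The origin of D = 1 - t + t R: put e(z) = \<Sum> z^n / (q)_n, so that e(qz) = (1 - z) e(z). For t
  \<noteq> 1 the functional equation is solved by R = (1 - t) e(z) / (e(tz) - t e(z)), and then D =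
  (1 - t) e(tz) / (e(tz) - t e(z)). The common denominator is why R and D behave alike under z ->
  qz. The closed form itself never enters; working with the functional equation alone also covers t
  = 1.\<close>

unbundle fps_syntax

section \<open>Descents at the end of a word\<close>

declare upt_Suc [simp del]

definition qpoch :: "real \<Rightarrow> nat \<Rightarrow> real" where
  "qpoch q n = (\<Prod>i=1..n. 1 - q ^ i)"

lemma qpoch_0 [simp]: "qpoch q 0 = 1"
  by (simp add: qpoch_def)

lemma qpoch_Suc: "qpoch q (Suc n) = (1 - q ^ Suc n) * qpoch q n"
  by (simp add: qpoch_def)

lemma pow_less_one: "0 < q \<Longrightarrow> q < 1 \<Longrightarrow> 0 < i \<Longrightarrow> q ^ i < (1::real)"
  using power_Suc_less_one[of q "i - 1"] by simp

lemma qpoch_pos: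
  assumes "0 < q" "q < 1"
  shows "qpoch q n > 0"
  unfolding qpoch_def
proof (rule prod_pos)
  fix i assume "i \<in> {1..n}"
  then have "q ^ i < 1" using pow_less_one[OF assms, of i] by simp
  then show "0 < 1 - q ^ i" by simp
qed

text \<open>A predicate on positions instead of a word, because the same expansion serves ordinary
  descents of multiset words and the modified descents of injections.\<close>

definition dsum :: "(nat \<Rightarrow> bool) \<Rightarrow> nat \<Rightarrow> nat" where
  "dsum d n = \<Sum>{i \<in> {1..<n}. d i}"

lemma dsum_0 [simp]: "dsum d 0 = 0"
  by (simp add: dsum_def)

lemma dsum_Suc: "dsum d (Suc n) = dsum d n + (if d n then n else 0)"
proof -
  have "{i \<in> {1..<Suc n}. d i} = (if d n \<and> n \<ge> 1 then insert n {i \<in> {1..<n}. d i} else {i \<in> {1..<n}. d i})"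
    by (auto simp: less_Suc_eq)
  then show ?thesis by (auto simp: dsum_def)
qed

lemma dsum_cong:
  assumes "\<And>i. 1 \<le> i \<Longrightarrow> i < n \<Longrightarrow> d i \<longleftrightarrow> d' i"
  shows "dsum d n = dsum d' n"
proof -
  have "{i \<in> {1..<n}. d i} = {i \<in> {1..<n}. d' i}"
    using assms by auto
  then show ?thesis by (simp add: dsum_def)
qed

text \<open>
  Read \<open>d\<close> as a descent set and the right-hand side as a sum over the final runs of
  consecutive descents. The identity turns a major index generating function into a signed sum
  over strictly decreasing tails, whose values form an arbitrary set; every recursion for a
  major index below is obtained in this way.
\<close>

lemma dsum_tail_expansion:
  assumes q: "0 < q" "q < 1"
  shows "q ^ n * q ^ dsum d n / qpoch q n =
    (\<Sum>r\<le>n. if \<forall>i. n - r < i \<and> i < n \<longrightarrow> d i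
             then (-1) ^ r * q ^ dsum d (n - r) / qpoch q (n - r) else 0)"
proof (induction n)
  case 0
  then show ?case by simp
next
  case (Suc n)
  let ?f = "\<lambda>n r. if \<forall>i. n - r < i \<and> i < n \<longrightarrow> d i
             then (-1) ^ r * q ^ dsum d (n - r) / qpoch q (n - r) else 0"
  have nz: "qpoch q m \<noteq> 0" for m using qpoch_pos[OF q, of m] by simp
  have "q ^ Suc n < 1" by (rule pow_less_one[OF q]) simp
  then have nz1: "1 - q ^ Suc n \<noteq> 0" by simp
  have "(\<Sum>r\<le>Suc n. ?f (Suc n) r) = ?f (Suc n) 0 + (\<Sum>r\<le>n. ?f (Suc n) (Suc r))"
    by (rule sum.atMost_Suc_shift)
  also have "?f (Suc n) 0 = q ^ dsum d (Suc n) / qpoch q (Suc n)"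
    by (auto dest: less_trans)
  also have "(\<Sum>r\<le>n. ?f (Suc n) (Suc r)) = - (q ^ dsum d (Suc n) / qpoch q n)"
  proof (cases "d n")
    \<comment> \<open>If \<open>n\<close> is a descent, a run of length \<open>Suc r\<close> before
      \<open>Suc n\<close> is a run of length \<open>r\<close> before \<open>n\<close>. The factor
      \<open>q ^ n\<close> of the induction hypothesis is exactly the increment of
      \<open>dsum\<close>.\<close>
    case True
    have "(\<Sum>r\<le>n. ?f (Suc n) (Suc r)) = (\<Sum>r\<le>n. - ?f n r)"
      by (rule sum.cong[OF refl]) (use True in \<open>auto simp: less_Suc_eq\<close>)
    also have "\<dots> = - (q ^ n * q ^ dsum d n / qpoch q n)"
      by (simp only: sum_negf Suc.IH)
    finally show ?thesis using True by (simp add: dsum_Suc power_add)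
  next
    \<comment> \<open>If \<open>n\<close> is not a descent, only the tail of length one survives,
      that is, \<open>r = 0\<close> after the shift.\<close>
    case False
    have "(\<Sum>r\<le>n. ?f (Suc n) (Suc r)) = (\<Sum>r\<le>n. if r = 0 then - (q ^ dsum d n / qpoch q n) else 0)"
    proof (rule sum.cong[OF refl])
      fix r assume "r \<in> {..n}"
      moreover have "\<not> (\<forall>i. Suc n - Suc r < i \<and> i < Suc n \<longrightarrow> d i)" if "r \<noteq> 0" "r \<le> n"
        using False that by (auto intro!: exI[of _ n])
      ultimately show "?f (Suc n) (Suc r) = (if r = 0 then - (q ^ dsum d n / qpoch q n) else 0)"
        by auto
    qed
    then show ?thesis using False by (simp add: dsum_Suc)
  qed
  also have "q ^ dsum d (Suc n) / qpoch q (Suc n) + - (q ^ dsum d (Suc n) / qpoch q n) =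
     q ^ Suc n * q ^ dsum d (Suc n) / qpoch q (Suc n)"
    using nz[of n] nz1 by (simp add: qpoch_Suc divide_simps) (simp add: algebra_simps)
  finally show ?case by simp
qed

section \<open>Lists determined by a set and a sort key\<close>

definition arrange :: "('a::linorder \<Rightarrow> real) \<Rightarrow> 'a set \<Rightarrow> 'a list" where
  "arrange f X = sort_key f (sorted_list_of_set X)"

lemma
  assumes "finite X"
  shows set_arrange: "set (arrange f X) = X"
    and length_arrange: "length (arrange f X) = card X"
    and distinct_arrange: "distinct (arrange f X)"
  using assms by (simp_all add: arrange_def)

lemma sorted_wrt_arrange:
  assumes "finite X" "inj_on f X"
  shows "sorted_wrt (\<lambda>a b. f a < f b) (arrange f X)"
proof -
  have "sorted (map f (arrange f X))" by (simp add: arrange_def)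
  moreover have "distinct (map f (arrange f X))"
    using assms by (simp add: distinct_map distinct_arrange set_arrange)
  ultimately have "sorted_wrt (<) (map f (arrange f X))" by (simp only: strict_sorted_iff)
  then show ?thesis by (simp add: sorted_wrt_map)
qed

text \<open>This lets a tail be recovered from its set of values. Keys are real numbers so that
  decreasing order, \<open>word_key\<close> and \<open>tail_key\<close> are all instances.\<close>

lemma arrange_set_eq:
  assumes "sorted_wrt (\<lambda>a b. f a < f b) ys" "inj_on f (set ys)"
  shows "arrange f (set ys) = ys"
proof -
  have "sorted_wrt (<) (map f ys)" using assms(1) by (simp add: sorted_wrt_map)
  moreover have "sorted_wrt (<) (map f (arrange f (set ys)))"
    using sorted_wrt_arrange[OF _ assms(2)] by (simp add: sorted_wrt_map)
  ultimately have "map f (arrange f (set ys)) = map f ys"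
    by (rule strict_sorted_equal) (simp add: set_arrange)
  then show ?thesis
    using assms(2) by (auto simp: set_arrange dest: map_inj_on)
qed

lemma bij_betw_permutes_list:
  "bij_betw (\<lambda>\<sigma>. map \<sigma> [1..<Suc n]) {\<sigma>. \<sigma> permutes {1..n}} (permutations_of_set {1..n})"
proof (rule bij_betwI[where g = "\<lambda>xs i. if i \<in> {1..n} then xs ! (i - 1) else i"])
  show "(\<lambda>\<sigma>. map \<sigma> [1..<Suc n]) \<in> {\<sigma>. \<sigma> permutes {1..n}} \<rightarrow> permutations_of_set {1..n}"
  proof
    fix \<sigma> assume "\<sigma> \<in> {\<sigma>. \<sigma> permutes {1..n}}"
    then have s: "\<sigma> permutes {1..n}" by simp
    have "\<sigma> ` {1..<Suc n} = {1..n}" using permutes_image[OF s] by (simp add: atLeastLessThanSuc_atLeastAtMost)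
    then show "map \<sigma> [1..<Suc n] \<in> permutations_of_set {1..n}"
      using permutes_inj_on[OF s] by (simp add: permutations_of_set_def distinct_map)
  qed
next
  show "(\<lambda>xs i. if i \<in> {1..n} then xs ! (i - 1) else i) \<in> permutations_of_set {1..n} \<rightarrow> {\<sigma>. \<sigma> permutes {1..n}}"
  proof
    fix xs assume "xs \<in> permutations_of_set {1..n}"
    then have xs: "set xs = {1..n}" "distinct xs" by (auto simp: permutations_of_set_def)
    then have len: "length xs = n" using distinct_card by fastforce
    let ?s = "\<lambda>i. if i \<in> {1..n} then xs ! (i - 1) else i"
    have "bij_betw ?s {1..n} {1..n}"
      unfolding bij_betw_def
    proof
      show "inj_on ?s {1..n}"
        using xs len by (auto simp: inj_on_def nth_eq_iff_index_eq)
      have "?s ` {1..n} = (\<lambda>i. xs ! i) ` ((\<lambda>i. i - 1) ` {1..n})"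
        unfolding image_image by (rule image_cong) auto
      also have "(\<lambda>i. i - 1) ` {1..n} = {..<n}"
      proof
        show "{..<n} \<subseteq> (\<lambda>i. i - 1) ` {1..n}"
        proof
          fix i assume "i \<in> {..<n}"
          then show "i \<in> (\<lambda>i. i - 1) ` {1..n}" by (intro image_eqI[of _ _ "Suc i"]) auto
        qed
      qed auto
      also have "(\<lambda>i. xs ! i) ` {..<n} = set xs" unfolding set_conv_nth len by auto
      finally show "?s ` {1..n} = {1..n}" using xs by simp
    qed
    then show "?s \<in> {\<sigma>. \<sigma> permutes {1..n}}" by (auto intro: bij_imp_permutes)
  qed
next
  fix \<sigma> assume "\<sigma> \<in> {\<sigma>. \<sigma> permutes {1..n}}"
  then have "\<sigma> i = i" if "i \<notin> {1..n}" for i using permutes_not_in that by fast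
  then show "(\<lambda>i. if i \<in> {1..n} then map \<sigma> [1..<Suc n] ! (i - 1) else i) = \<sigma>"
    by (intro ext) auto
next
  fix xs assume "xs \<in> permutations_of_set {1..n}"
  then have xs: "set xs = {1..n}" "distinct xs" by (auto simp: permutations_of_set_def)
  then have "length xs = n" using distinct_card by fastforce
  then show "map (\<lambda>i. if i \<in> {1..n} then xs ! (i - 1) else i) [1..<Suc n] = xs"
    by (intro nth_equalityI) auto
qed

section \<open>Equidistribution of inv and the inverse major index\<close>

definition lmaj :: "nat list \<Rightarrow> nat" where
  "lmaj w = dsum (\<lambda>i. w ! (i - 1) > w ! i) (length w)"

fun linv :: "nat list \<Rightarrow> nat" where
  "linv [] = 0"
| "linv (x # xs) = length (filter (\<lambda>y. y < x) xs) + linv xs"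

lemma strict_tail_iff:
  "(\<forall>i. m < i \<and> i < length w \<longrightarrow> w ! (i - 1) > w ! i) \<longleftrightarrow> sorted_wrt (>) (drop m (w :: nat list))"
proof -
  have "transp ((>) :: nat \<Rightarrow> _)" by (simp add: transp_on_greater)
  then have "sorted_wrt (>) (drop m w) \<longleftrightarrow> (\<forall>i. Suc (m + i) < length w \<longrightarrow> w ! (m + i) > w ! Suc (m + i))"
    by (subst sorted_wrt_iff_nth_Suc_transp) (auto simp: less_diff_conv add.commute)
  also have "\<dots> \<longleftrightarrow> (\<forall>i. m < i \<and> i < length w \<longrightarrow> w ! (i - 1) > w ! i)"
    by (metis add_diff_cancel_left' less_imp_Suc_add plus_1_eq_Suc less_add_Suc1)
  finally show ?thesis by simp
qed

text \<open>The summand at \<open>a\<close> is \<open>q\<close> to the total below \<open>a\<close>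
  minus \<open>q\<close> to the total up to and including \<open>a\<close>, so the sum telescopes
  along the order.\<close>

lemma sum_set_mset_telescope:
  fixes q :: real
  assumes "finite X"
  shows "(\<Sum>a\<in>X. q ^ (\<Sum>b\<in>{b\<in>X. b < a}. c b) * (1 - q ^ c a)) = 1 - q ^ (\<Sum>a\<in>X. c (a::nat))"
  using assms
proof (induction X rule: finite_linorder_max_induct)
  case empty
  then show ?case by simp
next
  case (insert m X)
  have 1: "{b \<in> insert m X. b < m} = X" using insert by auto
  have 2: "{b \<in> insert m X. b < a} = {b \<in> X. b < a}" if "a \<in> X" for a using insert that by fastforce
  have m: "m \<notin> X" using insert by auto
  have "(\<Sum>a\<in>insert m X. q ^ (\<Sum>b\<in>{b\<in>insert m X. b < a}. c b) * (1 - q ^ c a)) =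
    q ^ sum c X * (1 - q ^ c m) + (\<Sum>a\<in>X. q ^ (\<Sum>b\<in>{b\<in>X. b < a}. c b) * (1 - q ^ c a))"
    unfolding sum.insert[OF insert(1) m] 1 by (intro arg_cong2[of _ _ _ _ "(+)"] refl sum.cong) (simp only: 2)
  also have "\<dots> = 1 - q ^ (\<Sum>a\<in>insert m X. c a)"
    unfolding insert.IH using insert(1) m by (simp add: power_add algebra_simps)
  finally show ?case .
qed

text \<open>The q-multinomial coefficient of \<open>A\<close> divided by
  \<open>qpoch q (size A)\<close>.\<close>

definition mset_weight :: "real \<Rightarrow> nat multiset \<Rightarrow> real" where
  "mset_weight q A = (\<Prod>a\<in>set_mset A. 1 / qpoch q (count A a))"

lemma mset_weight_superset:
  assumes "finite X" "set_mset A \<subseteq> X"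
  shows "mset_weight q A = (\<Prod>a\<in>X. 1 / qpoch q (count A a))"
  unfolding mset_weight_def
  by (rule prod.mono_neutral_left) (use assms in \<open>auto simp: not_in_iff\<close>)

lemma mset_weight_remove:
  assumes q: "0 < q" "q < 1" and "a \<in># A"
  shows "mset_weight q (A - {#a#}) = mset_weight q A * (1 - q ^ count A a)"
proof -
  have "qpoch q (count A a) = (1 - q ^ count A a) * qpoch q (count A a - 1)"
    using count_greater_zero_iff[of A a] assms(3) by (cases "count A a") (simp_all add: qpoch_Suc)
  moreover have "qpoch q (count A a) > 0" by (rule qpoch_pos[OF q])
  moreover have "1 / y = 1 / (x * y) * x" if "x * y > 0" for x y :: real
    using that by auto
  ultimately have *: "1 / qpoch q (count A a - 1) = 1 / qpoch q (count A a) * (1 - q ^ count A a)"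
    by metis
  have "mset_weight q (A - {#a#}) = (\<Prod>b\<in>set_mset A. 1 / qpoch q (count (A - {#a#}) b))"
    by (rule mset_weight_superset) (auto dest: in_diffD)
  also have "\<dots> = 1 / qpoch q (count A a - 1) * (\<Prod>b\<in>set_mset A - {a}. 1 / qpoch q (count A b))"
    using assms(3) by (subst prod.remove[of _ a]) (auto intro!: arg_cong2[of _ _ _ _ "(*)"] prod.cong)
  also have "\<dots> = mset_weight q A * (1 - q ^ count A a)"
    unfolding * mset_weight_def using assms(3) by (subst (2) prod.remove[of _ a]) auto
  finally show ?thesis .
qed

lemma size_filter_less:
  "length (filter (\<lambda>y. y < a) xs) = (\<Sum>b\<in>{b\<in>set xs. b < a}. count (mset xs) b)"
proof -
  have "length (filter (\<lambda>y. y < a) xs) = size (filter_mset (\<lambda>y. y < a) (mset xs))"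
    by (metis mset_filter size_mset)
  also have "\<dots> = (\<Sum>b\<in>set_mset (filter_mset (\<lambda>y. y < a) (mset xs)). count (filter_mset (\<lambda>y. y < a) (mset xs)) b)"
    by (simp add: size_multiset_overloaded_eq)
  also have "\<dots> = (\<Sum>b\<in>{b\<in>set xs. b < a}. count (mset xs) b)"
    by (rule sum.cong) auto
  finally show ?thesis .
qed

text \<open>Induction on the first letter: \<open>a\<close> forms an inversion with each smaller
  letter of \<open>A\<close>, and the rest is any rearrangement of \<open>A - {#a#}\<close>. By
  \<open>mset_weight_remove\<close> the sum over \<open>a\<close> becomes the telescoping
  one.\<close>

lemma sum_linv:
  assumes q: "0 < q" "q < 1"
  shows "(\<Sum>w\<in>permutations_of_multiset A. q ^ linv w) = qpoch q (size A) * mset_weight q A"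
proof (induction "size A" arbitrary: A)
  case 0
  then show ?case by (simp add: mset_weight_def)
next
  case (Suc n)
  then have ne: "A \<noteq> {#}" by auto
  have "(\<Sum>w\<in>permutations_of_multiset A. q ^ linv w) =
     (\<Sum>a\<in>set_mset A. \<Sum>w\<in>(#) a ` permutations_of_multiset (A - {#a#}). q ^ linv w)"
    unfolding permutations_of_multiset_nonempty[OF ne]
    by (rule sum.UNION_disjoint) auto
  also have "\<dots> = (\<Sum>a\<in>set_mset A. q ^ (\<Sum>b\<in>{b\<in>set_mset A. b < a}. count A b) *
       (\<Sum>w\<in>permutations_of_multiset (A - {#a#}). q ^ linv w))"
  proof (rule sum.cong[OF refl])
    fix a assume a: "a \<in># A"
    have "length (filter (\<lambda>y. y < a) w) = (\<Sum>b\<in>{b\<in>set_mset A. b < a}. count A b)"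
      if "w \<in> permutations_of_multiset (A - {#a#})" for w
    proof -
      have m: "mset w = A - {#a#}" using that by (rule permutations_of_multisetD)
      have "b \<in># A - {#a#} \<longleftrightarrow> b \<in># A" if "b < a" for b using that
        by (simp add: in_diff_count count_greater_zero_iff flip: count_greater_zero_iff)
      then have "{b\<in>set w. b < a} = {b\<in>set_mset A. b < a}"
        unfolding set_mset_mset[symmetric] m by blast
      then show ?thesis unfolding size_filter_less by (auto simp: m intro!: sum.cong)
    qed
    then show "(\<Sum>w\<in>(#) a ` permutations_of_multiset (A - {#a#}). q ^ linv w) =
      q ^ (\<Sum>b\<in>{b\<in>set_mset A. b < a}. count A b) * (\<Sum>w\<in>permutations_of_multiset (A - {#a#}). q ^ linv w)"
      by (subst sum.reindex) (auto simp: sum_distrib_left power_add)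
  qed
  also have "\<dots> = (\<Sum>a\<in>set_mset A. q ^ (\<Sum>b\<in>{b\<in>set_mset A. b < a}. count A b) *
       (qpoch q n * (mset_weight q A * (1 - q ^ count A a))))"
  proof (rule sum.cong[OF refl])
    fix a assume a: "a \<in># A"
    have "size (A - {#a#}) = n" using Suc(2) a by (simp add: size_Diff_singleton)
    then show "q ^ (\<Sum>b\<in>{b\<in>set_mset A. b < a}. count A b) * (\<Sum>w\<in>permutations_of_multiset (A - {#a#}). q ^ linv w) =
      q ^ (\<Sum>b\<in>{b\<in>set_mset A. b < a}. count A b) * (qpoch q n * (mset_weight q A * (1 - q ^ count A a)))"
      using Suc(1)[of "A - {#a#}"] mset_weight_remove[OF q a] by simp
  qed
  also have "\<dots> = qpoch q n * mset_weight q A * (\<Sum>a\<in>set_mset A. q ^ (\<Sum>b\<in>{b\<in>set_mset A. b < a}. count A b) * (1 - q ^ count A a))"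
    by (simp add: sum_distrib_left mult_ac)
  also have "\<dots> = qpoch q n * mset_weight q A * (1 - q ^ size A)"
    by (subst sum_set_mset_telescope) (simp_all add: size_multiset_overloaded_eq)
  finally show ?case by (simp add: qpoch_Suc Suc(2)[symmetric] mult_ac)
qed

lemma lmaj_take:
  assumes "length w = n" "r \<le> n"
  shows "dsum (\<lambda>i. w ! (i - 1) > w ! i) (n - r) = lmaj (take (n - r) w)"
  unfolding lmaj_def using assms by (auto intro!: dsum_cong)

lemma mset_set_subseteq: "finite X \<Longrightarrow> X \<subseteq> set_mset A \<Longrightarrow> mset_set X \<subseteq># A"
  by (auto simp: subseteq_mset_def count_mset_set' Suc_le_eq)

lemma inj_on_neg_real: "inj_on (\<lambda>x::nat. - real x) X"
  by (simp add: inj_on_def)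

lemma strict_decreasing_distinct: "sorted_wrt (>) (ys :: nat list) \<Longrightarrow> distinct ys"
  by (induction ys) auto

text \<open>A strictly decreasing tail is determined by its set of letters \<open>T\<close>, and
  every set of letters of \<open>A\<close> occurs. What precedes it is an arbitrary rearrangement of
  the remaining multiset, because nothing is demanded where the two pieces meet.\<close>

lemma sum_strict_tails:
  fixes g :: "nat list \<Rightarrow> nat \<Rightarrow> real"
  assumes "size A = n"
  shows "(\<Sum>w\<in>permutations_of_multiset A. \<Sum>r\<le>n.
      if sorted_wrt (>) (drop (n - r) w) then g (take (n - r) w) r else 0) =
    (\<Sum>T\<in>Pow (set_mset A). \<Sum>u\<in>permutations_of_multiset (A - mset_set T). g u (card T))"
proof -
  let ?P = permutations_of_multiset
  let ?f = "\<lambda>x::nat. - real x"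
  have len: "length w = n" if "w \<in> ?P A" for w
    using permutations_of_multisetD[OF that] assms by auto
  have finT: "finite T" if "T \<subseteq> set_mset A" for T using that finite_subset by auto
  have "(\<Sum>w\<in>?P A. \<Sum>r\<le>n. if sorted_wrt (>) (drop (n - r) w) then g (take (n - r) w) r else 0) =
    (\<Sum>w\<in>?P A. \<Sum>r\<in>{r\<in>{..n}. sorted_wrt (>) (drop (n - r) w)}. g (take (n - r) w) r)"
    by (intro sum.cong refl sum.inter_filter[symmetric]) auto
  also have "\<dots> = (\<Sum>(w, r)\<in>Sigma (?P A) (\<lambda>w. {r\<in>{..n}. sorted_wrt (>) (drop (n - r) w)}). g (take (n - r) w) r)"
    by (rule sum.Sigma) auto
  also have "\<dots> = (\<Sum>(T, u)\<in>Sigma (Pow (set_mset A)) (\<lambda>T. ?P (A - mset_set T)). g u (card T))"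
  proof (rule sum.reindex_bij_witness[where
        i = "\<lambda>(T, u). (u @ arrange ?f T, card T)" and
        j = "\<lambda>(w, r). (set (drop (n - r) w), take (n - r) w)"], goal_cases)
    case (1 a)
    obtain w r where a: "a = (w, r)" by (cases a)
    from 1 a have w: "w \<in> ?P A" and r: "r \<le> n" and s: "sorted_wrt (>) (drop (n - r) w)" by auto
    have "arrange ?f (set (drop (n - r) w)) = drop (n - r) w"
      by (rule arrange_set_eq) (use s in \<open>auto simp: inj_on_neg_real\<close>)
    moreover have "distinct (drop (n - r) w)"
      by (rule strict_decreasing_distinct[OF s])
    ultimately show ?case using len[OF w] r by (simp add: a distinct_card)
  next
    case (2 a)
    obtain w r where a: "a = (w, r)" by (cases a)
    from 2 a have w: "w \<in> ?P A" and r: "r \<le> n" and s: "sorted_wrt (>) (drop (n - r) w)" by auto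
    have d: "distinct (drop (n - r) w)"
      by (rule strict_decreasing_distinct[OF s])
    have A: "A = mset (take (n - r) w) + mset (drop (n - r) w)"
      using permutations_of_multisetD[OF w] by (metis append_take_drop_id mset_append)
    then show ?case
      by (auto simp: a mset_set_set[OF d] intro!: permutations_of_multisetI)
  next
    case (3 b)
    obtain T u where b: "b = (T, u)" by (cases b)
    with 3 have T: "T \<subseteq> set_mset A" and u: "u \<in> ?P (A - mset_set T)" by auto
    note f = finT[OF T]
    have "length u = n - card T" 
      using permutations_of_multisetD[OF u] mset_set_subseteq[OF f T] assms
      by (metis size_Diff_submset size_mset size_mset_set)
    moreover have "card T \<le> n" using mset_set_subseteq[OF f T] assms
      by (metis size_mset_mono size_mset_set)
    ultimately show ?case by (simp add: b set_arrange[OF f])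
  next
    case (4 b)
    obtain T u where b: "b = (T, u)" by (cases b)
    with 4 have T: "T \<subseteq> set_mset A" and u: "u \<in> ?P (A - mset_set T)" by auto
    note f = finT[OF T]
    have l: "length u = n - card T" 
      using permutations_of_multisetD[OF u] mset_set_subseteq[OF f T] assms
      by (metis size_Diff_submset size_mset size_mset_set)
    have c: "card T \<le> n" using mset_set_subseteq[OF f T] assms
      by (metis size_mset_mono size_mset_set)
    have "mset (arrange ?f T) = mset_set T"
      by (metis distinct_arrange f mset_set_set set_arrange)
    then have "mset (u @ arrange ?f T) = A"
      using permutations_of_multisetD[OF u] mset_set_subseteq[OF f T] by simp
    moreover have "sorted_wrt (>) (arrange ?f T)"
      using sorted_wrt_arrange[OF f inj_on_neg_real] by simp
    ultimately show ?case using l c by (auto simp: b intro!: permutations_of_multisetI)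
  next
    case (5 a)
    obtain w r where a: "a = (w, r)" by (cases a)
    from 5 a have w: "w \<in> ?P A" and r: "r \<le> n" and s: "sorted_wrt (>) (drop (n - r) w)" by auto
    have d: "distinct (drop (n - r) w)"
      by (rule strict_decreasing_distinct[OF s])
    then show ?case using len[OF w] r by (simp add: a distinct_card)
  qed
  also have "\<dots> = (\<Sum>T\<in>Pow (set_mset A). \<Sum>u\<in>?P (A - mset_set T). g u (card T))"
    by (rule sum.Sigma[symmetric]) auto
  finally show ?thesis .
qed

text \<open>MacMahon's theorem. The normalised sum \<open>?F\<close> and \<open>mset_weight\<close>
  satisfy the same recursion over the tail sets \<open>T\<close>; by induction they agree on all
  nonempty \<open>T\<close>, and the empty one leaves the factor \<open>1 - q ^ size A\<close> to
  cancel.\<close>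

lemma sum_lmaj:
  assumes q: "0 < q" "q < 1"
  shows "(\<Sum>w\<in>permutations_of_multiset A. q ^ lmaj w) = qpoch q (size A) * mset_weight q A"
proof (induction "size A" arbitrary: A rule: less_induct)
  case less
  let ?P = permutations_of_multiset
  let ?n = "size A"
  let ?F = "\<lambda>A. (\<Sum>w\<in>?P A. q ^ lmaj w) / qpoch q (size A)"
  have nz: "qpoch q m \<noteq> 0" for m using qpoch_pos[OF q, of m] by simp
  show ?case
  proof (cases "A = {#}")
    case True
    then show ?thesis by (simp add: mset_weight_def lmaj_def)
  next
    case False
    have len: "length w = ?n" if "w \<in> ?P A" for w
      using permutations_of_multisetD[OF that] by auto
    have finT: "finite T" if "T \<subseteq> set_mset A" for T using that finite_subset by auto
    have sz: "size (A - mset_set T) = ?n - card T" if "T \<subseteq> set_mset A" for T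
      using mset_set_subseteq[OF finT[OF that] that] by (simp add: size_Diff_submset)
    have "q ^ ?n * ?F A = (\<Sum>w\<in>?P A. q ^ ?n * q ^ lmaj w / qpoch q ?n)"
      by (simp add: sum_divide_distrib sum_distrib_left)
    also have "\<dots> = (\<Sum>w\<in>?P A. \<Sum>r\<le>?n. if sorted_wrt (>) (drop (?n - r) w) then
        (-1) ^ r * q ^ lmaj (take (?n - r) w) / qpoch q (length (take (?n - r) w)) else 0)"
    proof (rule sum.cong[OF refl])
      fix w assume w: "w \<in> ?P A"
      have "q ^ ?n * q ^ lmaj w / qpoch q ?n = (\<Sum>r\<le>?n. if \<forall>i. ?n - r < i \<and> i < ?n \<longrightarrow> w ! (i - 1) > w ! i
             then (-1) ^ r * q ^ dsum (\<lambda>i. w ! (i - 1) > w ! i) (?n - r) / qpoch q (?n - r) else 0)"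
        using dsum_tail_expansion[OF q, of ?n "\<lambda>i. w ! (i - 1) > w ! i"] by (simp add: lmaj_def len[OF w])
      also have "\<dots> = (\<Sum>r\<le>?n. if sorted_wrt (>) (drop (?n - r) w) then
        (-1) ^ r * q ^ lmaj (take (?n - r) w) / qpoch q (length (take (?n - r) w)) else 0)"
        using strict_tail_iff[of _ w] len[OF w] lmaj_take[OF len[OF w]] by (intro sum.cong refl) auto
      finally show "q ^ ?n * q ^ lmaj w / qpoch q ?n = \<dots>" .
    qed
    also have "\<dots> = (\<Sum>T\<in>Pow (set_mset A). \<Sum>u\<in>?P (A - mset_set T). (-1) ^ card T * q ^ lmaj u / qpoch q (length u))"
      by (rule sum_strict_tails[where g = "\<lambda>u r. (-1) ^ r * q ^ lmaj u / qpoch q (length u)"]) simp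
    also have "\<dots> = (\<Sum>T\<in>Pow (set_mset A). (-1) ^ card T * ?F (A - mset_set T))"
    proof (rule sum.cong[OF refl])
      fix T
      have "(\<Sum>u\<in>?P (A - mset_set T). (-1) ^ card T * q ^ lmaj u / qpoch q (length u)) =
        (\<Sum>u\<in>?P (A - mset_set T). (-1) ^ card T * q ^ lmaj u / qpoch q (size (A - mset_set T)))"
        by (intro sum.cong refl) (simp add: length_finite_permutations_of_multiset)
      then show "(\<Sum>u\<in>?P (A - mset_set T). (-1) ^ card T * q ^ lmaj u / qpoch q (length u)) = (-1) ^ card T * ?F (A - mset_set T)"
        by (simp add: sum_divide_distrib sum_distrib_left)
    qed
    also have "\<dots> = ?F A + (\<Sum>T\<in>Pow (set_mset A) - {{}}. (-1) ^ card T * ?F (A - mset_set T))"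
      by (subst sum.remove[of _ "{}"]) auto
    also have "(\<Sum>T\<in>Pow (set_mset A) - {{}}. (-1) ^ card T * ?F (A - mset_set T)) =
      (\<Sum>T\<in>Pow (set_mset A) - {{}}. (-1) ^ card T * mset_weight q (A - mset_set T))"
    proof (rule sum.cong[OF refl])
      fix T assume T: "T \<in> Pow (set_mset A) - {{}}"
      then have "card T > 0" using finT[of T] by (auto simp: card_gt_0_iff)
      moreover have "?n > 0" using False by (simp add: nonempty_has_size)
      ultimately have "size (A - mset_set T) < ?n" using T sz by auto
      from less[OF this] nz show "(-1) ^ card T * ?F (A - mset_set T) = (-1) ^ card T * mset_weight q (A - mset_set T)"
        by simp
    qed
    also have "\<dots> = (\<Sum>T\<in>Pow (set_mset A). (-1) ^ card T * mset_weight q (A - mset_set T)) - mset_weight q A"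
      by (subst (2) sum.remove[of _ "{}"]) auto
    \<comment> \<open>The signed sum over \<open>T\<close> factorises over the letters. A letter of
      multiplicity c contributes 1/(q)_c - 1/(q)_(c-1) = q^c/(q)_c.\<close>
    also have "(\<Sum>T\<in>Pow (set_mset A). (-1) ^ card T * mset_weight q (A - mset_set T)) = q ^ ?n * mset_weight q A"
    proof -
      let ?c = "count A"
      have "(\<Sum>T\<in>Pow (set_mset A). (-1) ^ card T * mset_weight q (A - mset_set T)) =
        (\<Sum>T\<in>Pow (set_mset A). (-1) ^ card T * (\<Prod>a\<in>T. 1 / qpoch q (?c a - 1)) * (\<Prod>a\<in>set_mset A - T. 1 / qpoch q (?c a)))"
      proof (rule sum.cong[OF refl])
        fix T assume T: "T \<in> Pow (set_mset A)"
        then have f: "finite T" using finT by auto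
        have "mset_weight q (A - mset_set T) = (\<Prod>a\<in>set_mset A. 1 / qpoch q (count (A - mset_set T) a))"
          by (rule mset_weight_superset) (auto dest: in_diffD)
        also have "\<dots> = (\<Prod>a\<in>T. 1 / qpoch q (?c a - 1)) * (\<Prod>a\<in>set_mset A - T. 1 / qpoch q (?c a))"
          using T f by (subst prod.subset_diff[of T]) (auto simp: mult.commute intro!: arg_cong2[of _ _ _ _ "(*)"] prod.cong)
        finally show "(-1) ^ card T * mset_weight q (A - mset_set T) =
          (-1) ^ card T * (\<Prod>a\<in>T. 1 / qpoch q (?c a - 1)) * (\<Prod>a\<in>set_mset A - T. 1 / qpoch q (?c a))" by simp
      qed
      also have "\<dots> = (\<Prod>a\<in>set_mset A. 1 / qpoch q (?c a) - 1 / qpoch q (?c a - 1))"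
        by (rule prod_diff_conv_sum[symmetric]) simp
      also have "\<dots> = (\<Prod>a\<in>set_mset A. q ^ ?c a * (1 / qpoch q (?c a)))"
      proof (rule prod.cong[OF refl])
        fix a assume a: "a \<in> set_mset A"
        then obtain k where "?c a = Suc k" by (metis count_greater_zero_iff gr0_conv_Suc)
        then show "1 / qpoch q (?c a) - 1 / qpoch q (?c a - 1) = q ^ ?c a * (1 / qpoch q (?c a))"
          using nz[of "Suc k"] nz[of k] by (simp add: qpoch_Suc field_simps)
      qed
      also have "\<dots> = q ^ ?n * mset_weight q A"
        by (simp only: prod.distrib power_sum size_multiset_overloaded_eq mset_weight_def)
      finally show ?thesis .
    qed
    finally have "(1 - q ^ ?n) * ?F A = (1 - q ^ ?n) * mset_weight q A"
      by (simp only: left_diff_distrib mult_1_left)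
    moreover have "1 - q ^ ?n \<noteq> 0"
      using pow_less_one[OF q, of ?n] False by (simp add: nonempty_has_size)
    ultimately have "?F A = mset_weight q A" using mult_left_cancel by blast
    then show ?thesis using nz[of ?n] by (simp add: field_simps)
  qed
qed

section \<open>Permutations with prescribed possible descents as words\<close>

lemma linv_conv_card: "linv w = card {(i, j). i < j \<and> j < length w \<and> w ! i > w ! j}"
proof (induction w)
  case Nil
  then show ?case by simp
next
  case (Cons x xs)
  let ?I = "{(i, j). i < j \<and> j < length xs \<and> xs ! i > xs ! j}"
  have fin: "finite ?I"
    by (rule finite_subset[of _ "{..<length xs} \<times> {..<length xs}"]) auto
  have "{(i, j). i < j \<and> j < length (x # xs) \<and> (x # xs) ! i > (x # xs) ! j} =
    (\<lambda>j. (0, Suc j)) ` {j. j < length xs \<and> xs ! j < x} \<union> (\<lambda>(i, j). (Suc i, Suc j)) ` ?I" (is "?L = ?R")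
  proof (intro set_eqI iffI)
    fix a assume "a \<in> ?L"
    then obtain i j where a: "a = (i, j)" "i < j" "j < length (x # xs)" "(x # xs) ! i > (x # xs) ! j" by auto
    then obtain j' where j: "j = Suc j'" by (cases j) auto
    show "a \<in> ?R"
    proof (cases i)
      case 0
      then show ?thesis using a j by auto
    next
      case (Suc i')
      then have "(i', j') \<in> ?I" using a j by auto
      then have "(\<lambda>(i, j). (Suc i, Suc j)) (i', j') \<in> ?R" by blast
      then show ?thesis using a j Suc by simp
    qed
  qed auto
  then have "card {(i, j). i < j \<and> j < length (x # xs) \<and> (x # xs) ! i > (x # xs) ! j} = card ?R"
    by (rule arg_cong)
  also have "card ?R = card ((\<lambda>j. (0::nat, Suc j)) ` {j. j < length xs \<and> xs ! j < x}) + card ((\<lambda>(i, j). (Suc i, Suc j)) ` ?I)"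
  proof (rule card_Un_disjoint)
    have "finite {j. j < length xs \<and> xs ! j < x}"
      by (rule finite_subset[of _ "{..<length xs}"]) auto
    then show "finite ((\<lambda>j. (0::nat, Suc j)) ` {j. j < length xs \<and> xs ! j < x})" by (rule finite_imageI)
    show "finite ((\<lambda>(i, j). (Suc i, Suc j)) ` ?I)" by (rule finite_imageI[OF fin])
  qed (rule equals0I, clarsimp)
  also have "\<dots> = card {j. j < length xs \<and> xs ! j < x} + card ?I"
  proof -
    have 1: "card ((\<lambda>j. (0::nat, Suc j)) ` A) = card A" for A
      by (rule card_image) (simp add: inj_on_def)
    have 2: "card ((\<lambda>(i, j). (Suc i, Suc j)) ` B) = card B" for B
      by (rule card_image) (auto simp: inj_on_def)
    show ?thesis by (simp only: 1 2)
  qed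
  finally show ?case using Cons.IH by (simp add: length_filter_conv_card)
qed

text \<open>
  The number of the block containing \<open>i\<close> when \<open>[n]\<close> is cut after each element of \<open>S\<close>.
\<close>

definition blk :: "nat set \<Rightarrow> nat \<Rightarrow> nat" where
  "blk S i = card {s \<in> S. s < i}"

definition block_word :: "nat \<Rightarrow> nat set \<Rightarrow> (nat \<Rightarrow> nat) \<Rightarrow> nat list" where
  "block_word n S \<sigma> = map (\<lambda>p. blk S (inv \<sigma> p)) [1..<Suc n]"

context
  fixes n :: nat and S :: "nat set"
  assumes S: "S \<subseteq> {1..n-1}"
begin

lemma finite_S: "finite S"
  by (rule finite_subset[OF S]) simp

lemma blk_mono: "i \<le> j \<Longrightarrow> blk S i \<le> blk S j"
  unfolding blk_def by (rule card_mono) (use finite_S in auto)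

lemma blk_eqD:
  assumes "blk S i = blk S j" "i \<le> k" "k < j"
  shows "k \<notin> S"
proof
  assume "k \<in> S"
  then have "k \<in> {s \<in> S. s < j}" "k \<notin> {s \<in> S. s < i}" using assms(2,3) by simp_all
  moreover have "{s \<in> S. s < i} \<subseteq> {s \<in> S. s < j}" using assms(2,3) by auto
  ultimately have "{s \<in> S. s < i} \<subset> {s \<in> S. s < j}" by blast
  then have "blk S i < blk S j" unfolding blk_def by (intro psubset_card_mono) (simp_all add: finite_S)
  then show False using assms(1) by simp
qed

lemma blk_SucD: "blk S i < blk S (Suc i) \<Longrightarrow> i \<in> S"
proof (rule ccontr)
  assume "blk S i < blk S (Suc i)" "i \<notin> S"
  moreover have "{s \<in> S. s < Suc i} = {s \<in> S. s < i}" using \<open>i \<notin> S\<close> by (auto simp: less_Suc_eq)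
  ultimately show False by (simp add: blk_def)
qed

lemma increasing_on_blocks:
  assumes s: "\<sigma> permutes {1..n}" and D: "DES n \<sigma> \<subseteq> S"
    and i: "1 \<le> i" "i < j" "j \<le> n" and b: "blk S i = blk S j"
  shows "\<sigma> i < \<sigma> j"
proof -
  have "i < k \<longrightarrow> k \<le> j \<longrightarrow> \<sigma> i < \<sigma> k" for k
  proof (induction k)
    case 0
    then show ?case by simp
  next
    case (Suc k)
    show ?case
    proof (intro impI)
      assume k: "i < Suc k" "Suc k \<le> j"
      then have "k \<notin> S" using blk_eqD[OF b, of k] by simp
      then have "k \<notin> DES n \<sigma>" using D by auto
      then have "\<sigma> k \<le> \<sigma> (Suc k)" using k i by (auto simp: DES_def)
      moreover have "\<sigma> k \<noteq> \<sigma> (Suc k)" by (simp add: inj_eq[OF permutes_inj[OF s]])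
      ultimately show "\<sigma> i < \<sigma> (Suc k)" using Suc k by (cases "i = k") auto
    qed
  qed
  then show ?thesis using i by simp
qed

lemma length_block_word [simp]: "length (block_word n S \<sigma>) = n"
  by (simp add: block_word_def)

lemma nth_block_word: "1 \<le> p \<Longrightarrow> p \<le> n \<Longrightarrow> block_word n S \<sigma> ! (p - 1) = blk S (inv \<sigma> p)"
  by (cases p) (simp_all add: block_word_def)

text \<open>Values in one block occur in increasing order, so passing to block numbers hides no
  inversion of \<open>inv \<sigma>\<close>. Arbitrary pairs \<open>p < p'\<close> are covered, since
  \<open>maj\<close> needs the adjacent ones and \<open>inversion_number\<close> needs all.\<close>

lemma descents_block_word:
  assumes s: "\<sigma> permutes {1..n}" and D: "DES n \<sigma> \<subseteq> S"
    and p: "1 \<le> p" "p < p'" "p' \<le> n"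
  shows "blk S (inv \<sigma> p) > blk S (inv \<sigma> p') \<longleftrightarrow> inv \<sigma> p > inv \<sigma> p'"
proof
  assume "blk S (inv \<sigma> p) > blk S (inv \<sigma> p')"
  then show "inv \<sigma> p > inv \<sigma> p'" using blk_mono[of "inv \<sigma> p" "inv \<sigma> p'"] by linarith
next
  assume g: "inv \<sigma> p > inv \<sigma> p'"
  have "inv \<sigma> p \<in> {1..n}" "inv \<sigma> p' \<in> {1..n}"
    using p permutes_in_image[OF permutes_inv[OF s]] by auto
  moreover have "\<sigma> (inv \<sigma> p) = p" "\<sigma> (inv \<sigma> p') = p'" using permutes_inverses[OF s] by auto
  ultimately have "blk S (inv \<sigma> p') \<noteq> blk S (inv \<sigma> p)"
    using increasing_on_blocks[OF s D, of "inv \<sigma> p'" "inv \<sigma> p"] g p by auto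
  then show "blk S (inv \<sigma> p) > blk S (inv \<sigma> p')"
    using blk_mono[of "inv \<sigma> p'" "inv \<sigma> p"] g by simp
qed

lemma lmaj_block_word:
  assumes s: "\<sigma> permutes {1..n}" and D: "DES n \<sigma> \<subseteq> S"
  shows "lmaj (block_word n S \<sigma>) = maj n (inv \<sigma>)"
proof -
  have "{i \<in> {1..<n}. block_word n S \<sigma> ! (i - 1) > block_word n S \<sigma> ! i} = DES n (inv \<sigma>)"
    using descents_block_word[OF s D] nth_block_word[of _ \<sigma>] nth_block_word[of "Suc _" \<sigma>]
    unfolding DES_def by auto
  then show ?thesis by (simp add: lmaj_def dsum_def maj_def)
qed

lemma linv_block_word:
  assumes s: "\<sigma> permutes {1..n}" and D: "DES n \<sigma> \<subseteq> S"
  shows "linv (block_word n S \<sigma>) = inversion_number n \<sigma>"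
  unfolding linv_conv_card inversion_number_def
proof (rule bij_betw_same_card[OF bij_betw_byWitness[where f = "\<lambda>(i, j). (inv \<sigma> (Suc j), inv \<sigma> (Suc i))"
        and f' = "\<lambda>(a, b). (\<sigma> b - 1, \<sigma> a - 1)"]])
  note iv = permutes_inverses[OF s]
  have im: "inv \<sigma> p \<in> {1..n} \<longleftrightarrow> p \<in> {1..n}" "\<sigma> p \<in> {1..n} \<longleftrightarrow> p \<in> {1..n}" for p
    using permutes_in_image[OF permutes_inv[OF s]] permutes_in_image[OF s] by auto
  let ?L = "{(i, j). i < j \<and> j < length (block_word n S \<sigma>) \<and> block_word n S \<sigma> ! j < block_word n S \<sigma> ! i}"
  let ?R = "{(i, j). 1 \<le> i \<and> i < j \<and> j \<le> n \<and> \<sigma> j < \<sigma> i}"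
  show "\<forall>a\<in>?L. (\<lambda>(a, b). (\<sigma> b - 1, \<sigma> a - 1)) ((\<lambda>(i, j). (inv \<sigma> (Suc j), inv \<sigma> (Suc i))) a) = a"
    by (auto simp: iv)
  show "\<forall>a\<in>?R. (\<lambda>(i, j). (inv \<sigma> (Suc j), inv \<sigma> (Suc i))) ((\<lambda>(a, b). (\<sigma> b - 1, \<sigma> a - 1)) a) = a"
  proof (clarify, intro conjI)
    fix a b assume "1 \<le> a" "a < b" "b \<le> n" "\<sigma> b < \<sigma> a"
    then show "inv \<sigma> (Suc (\<sigma> a - 1)) = a" "inv \<sigma> (Suc (\<sigma> b - 1)) = b"
      using im(2)[of a] im(2)[of b] by (auto simp: iv)
  qed
  show "(\<lambda>(i, j). (inv \<sigma> (Suc j), inv \<sigma> (Suc i))) ` ?L \<subseteq> ?R"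
  proof (clarify)
    fix i j assume a: "i < j" "j < length (block_word n S \<sigma>)" "block_word n S \<sigma> ! j < block_word n S \<sigma> ! i"
    then have "inv \<sigma> (Suc j) < inv \<sigma> (Suc i)"
      using descents_block_word[OF s D, of "Suc i" "Suc j"] nth_block_word[of "Suc i" \<sigma>] nth_block_word[of "Suc j" \<sigma>] by simp
    then show "1 \<le> inv \<sigma> (Suc j) \<and> inv \<sigma> (Suc j) < inv \<sigma> (Suc i) \<and> inv \<sigma> (Suc i) \<le> n \<and> \<sigma> (inv \<sigma> (Suc i)) < \<sigma> (inv \<sigma> (Suc j))"
      using im(1)[of "Suc i"] im(1)[of "Suc j"] a by (auto simp: iv)
  qed
  show "(\<lambda>(a, b). (\<sigma> b - 1, \<sigma> a - 1)) ` ?R \<subseteq> ?L"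
  proof (clarify, intro conjI)
    fix a b assume a: "1 \<le> a" "a < b" "b \<le> n" "\<sigma> b < \<sigma> a"
    have m: "1 \<le> \<sigma> b" "\<sigma> a \<le> n" using im(2)[of a] im(2)[of b] a by auto
    then show "\<sigma> b - 1 < \<sigma> a - 1" "\<sigma> a - 1 < length (block_word n S \<sigma>)" using a by auto
    show "block_word n S \<sigma> ! (\<sigma> a - 1) < block_word n S \<sigma> ! (\<sigma> b - 1)"
      using descents_block_word[OF s D, of "\<sigma> b" "\<sigma> a"] nth_block_word[of "\<sigma> b" \<sigma>] nth_block_word[of "\<sigma> a" \<sigma>] m a
      by (simp add: iv)
  qed
qed

text \<open>The lexicographic order on pairs (letter, position) as a single number; the multiplier
  \<open>Suc n\<close> exceeds every position.\<close>

definition word_key :: "nat list \<Rightarrow> nat \<Rightarrow> real" where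
  "word_key w p = real (w ! (p - 1) * Suc n + p)"

lemma inj_word_key: "inj_on (word_key w) {1..n}"
proof (rule inj_onI)
  fix x y assume xy: "x \<in> {1..n}" "y \<in> {1..n}" "word_key w x = word_key w y"
  then have "(w ! (x - 1) * Suc n + x) mod Suc n = (w ! (y - 1) * Suc n + y) mod Suc n"
    unfolding word_key_def of_nat_eq_iff by simp
  then show "x = y" using xy by (simp add: mod_mult_self4 del: mult_Suc_right)
qed

lemma word_key_less:
  assumes "p \<in> {1..n}" "p' \<in> {1..n}"
  shows "word_key w p < word_key w p' \<longleftrightarrow> w ! (p - 1) < w ! (p' - 1) \<or> w ! (p - 1) = w ! (p' - 1) \<and> p < p'"
proof -
  have *: "a * Suc n + x < b * Suc n + y" if "a < b" "x \<in> {1..n}" for a b x y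
  proof -
    have "a * Suc n + x < Suc a * Suc n" using that by simp
    also have "\<dots> \<le> b * Suc n" using that by (intro mult_le_mono1) simp
    finally show ?thesis by simp
  qed
  show ?thesis
    unfolding word_key_def of_nat_less_iff
    using *[of "w ! (p - 1)" "w ! (p' - 1)" p p'] *[of "w ! (p' - 1)" "w ! (p - 1)" p' p] assms
    by (cases "w ! (p - 1)" "w ! (p' - 1)" rule: linorder_cases) auto
qed

text \<open>The permutation lists its values block by block, increasingly within each block, so the
  word alone determines it. This gives injectivity of \<open>block_word\<close>.\<close>

lemma perm_list_eq_arrange:
  assumes s: "\<sigma> permutes {1..n}" and D: "DES n \<sigma> \<subseteq> S"
  shows "map \<sigma> [1..<Suc n] = arrange (word_key (block_word n S \<sigma>)) {1..n}"
proof -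
  let ?f = "word_key (block_word n S \<sigma>)"
  have set: "set (map \<sigma> [1..<Suc n]) = {1..n}"
    using bij_betw_apply[OF bij_betw_permutes_list, of \<sigma> n] s by (simp add: permutations_of_set_def)
  have im: "\<sigma> p \<in> {1..n} \<longleftrightarrow> p \<in> {1..n}" for p
    using permutes_in_image[OF s] by auto
  have "sorted_wrt (\<lambda>a b. ?f a < ?f b) (map \<sigma> [1..<Suc n])"
    unfolding sorted_wrt_iff_nth_less
  proof (intro allI impI)
    fix i j assume "i < j" "j < length (map \<sigma> [1..<Suc n])"
    then have ij: "i < j" "j < n" by simp_all
    have "?f (\<sigma> (Suc i)) < ?f (\<sigma> (Suc j))"
    proof (subst word_key_less)
      show in1: "\<sigma> (Suc i) \<in> {1..n}" "\<sigma> (Suc j) \<in> {1..n}" using im[of "Suc i"] im[of "Suc j"] ij by simp_all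
      have w: "block_word n S \<sigma> ! (\<sigma> (Suc i) - 1) = blk S (Suc i)" "block_word n S \<sigma> ! (\<sigma> (Suc j) - 1) = blk S (Suc j)"
        using in1 nth_block_word[of "\<sigma> (Suc i)" \<sigma>] nth_block_word[of "\<sigma> (Suc j)" \<sigma>]
        by (simp_all add: permutes_inverses[OF s])
      show "block_word n S \<sigma> ! (\<sigma> (Suc i) - 1) < block_word n S \<sigma> ! (\<sigma> (Suc j) - 1) \<or>
        block_word n S \<sigma> ! (\<sigma> (Suc i) - 1) = block_word n S \<sigma> ! (\<sigma> (Suc j) - 1) \<and> \<sigma> (Suc i) < \<sigma> (Suc j)"
        unfolding w using blk_mono[of "Suc i" "Suc j"] increasing_on_blocks[OF s D, of "Suc i" "Suc j"] ij by auto
    qed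
    then show "?f (map \<sigma> [1..<Suc n] ! i) < ?f (map \<sigma> [1..<Suc n] ! j)" using ij by simp
  qed
  from arrange_set_eq[OF this] show ?thesis using inj_word_key by (simp only: set)
qed

lemma bij_betw_block_word:
  "bij_betw (block_word n S) {\<sigma>. \<sigma> permutes {1..n} \<and> DES n \<sigma> \<subseteq> S}
     (permutations_of_multiset (image_mset (blk S) (mset_set {1..n})))"
  unfolding bij_betw_def
proof
  let ?C = "{\<sigma>. \<sigma> permutes {1..n} \<and> DES n \<sigma> \<subseteq> S}"
  let ?A = "image_mset (blk S) (mset_set {1..n})"
  have mset_upt: "mset [1..<Suc n] = mset_set {1..n}"
    by (metis atLeastLessThanSuc_atLeastAtMost distinct_upt mset_set_set set_upt)
  show "inj_on (block_word n S) ?C"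
  proof (rule inj_onI)
    fix \<sigma> \<tau> assume "\<sigma> \<in> ?C" "\<tau> \<in> ?C" "block_word n S \<sigma> = block_word n S \<tau>"
    then have "map \<sigma> [1..<Suc n] = map \<tau> [1..<Suc n]"
      using perm_list_eq_arrange by simp
    then show "\<sigma> = \<tau>"
      using \<open>\<sigma> \<in> ?C\<close> \<open>\<tau> \<in> ?C\<close>
      by (intro inj_onD[OF bij_betw_imp_inj_on[OF bij_betw_permutes_list[of n]]]) simp_all
  qed
  show "block_word n S ` ?C = permutations_of_multiset ?A"
  proof (intro subset_antisym subsetI)
    fix w assume "w \<in> block_word n S ` ?C"
    then obtain \<sigma> where s: "\<sigma> permutes {1..n}" and w: "w = block_word n S \<sigma>" by auto
    have "mset w = image_mset (blk S) (image_mset (inv \<sigma>) (mset_set {1..n}))"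
      by (simp add: w block_word_def mset_upt multiset.map_comp o_def atLeastLessThanSuc_atLeastAtMost)
    also have "image_mset (inv \<sigma>) (mset_set {1..n}) = mset_set {1..n}"
      using permutes_inv[OF s] by (subst image_mset_mset_set) (auto simp: permutes_inj_on permutes_image)
    finally show "w \<in> permutations_of_multiset ?A" by (rule permutations_of_multisetI)
  next
    fix w assume "w \<in> permutations_of_multiset ?A"
    then have w: "mset w = ?A" by (rule permutations_of_multisetD)
    then have lw: "length w = n" by (metis card_atLeastAtMost diff_Suc_1 size_image_mset size_mset size_mset_set)
    \<comment> \<open>The preimage of \<open>w\<close>: list the values by their letters, ties by
      size, and read the list as one-line notation.\<close>
    let ?f = "word_key w"
    define xs where "xs = arrange ?f {1..n}"
    have xs: "set xs = {1..n}" "distinct xs" "length xs = n"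
      by (simp_all add: xs_def set_arrange distinct_arrange length_arrange)
    have srt: "sorted_wrt (\<lambda>a b. ?f a < ?f b) xs"
      unfolding xs_def by (rule sorted_wrt_arrange[OF _ inj_word_key]) simp
    have "xs \<in> permutations_of_set {1..n}" using xs by (simp add: permutations_of_set_def)
    then have "xs \<in> (\<lambda>\<sigma>. map \<sigma> [1..<Suc n]) ` {\<sigma>. \<sigma> permutes {1..n}}"
      by (simp only: bij_betw_imp_surj_on[OF bij_betw_permutes_list[of n]])
    then obtain \<sigma> where "\<sigma> \<in> {\<sigma>. \<sigma> permutes {1..n}}" and xs_map: "xs = map \<sigma> [1..<Suc n]"
      by (rule imageE)
    then have s: "\<sigma> permutes {1..n}" by (simp only: mem_Collect_eq)
    note sx = xs_map[symmetric]
    have sn: "xs ! i = \<sigma> (Suc i)" if "i < n" for i using that by (simp add: xs_map)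
    have in1: "xs ! i \<in> {1..n}" if "i < n" for i using that xs by (metis nth_mem)
    let ?g = "\<lambda>p. w ! (p - 1)"
    have "sorted (map ?g xs)"
      unfolding sorted_iff_nth_mono_less
    proof (intro allI impI)
      fix i j assume ij: "i < j" "j < length (map ?g xs)"
      then have "?f (xs ! i) < ?f (xs ! j)" using srt by (simp add: sorted_wrt_iff_nth_less)
      then show "map ?g xs ! i \<le> map ?g xs ! j" using word_key_less[of "xs ! i" "xs ! j" w] in1 ij xs by auto
    qed
    moreover have "sorted (map (blk S) [1..<Suc n])"
      by (auto simp: sorted_iff_nth_mono_less intro!: blk_mono)
    moreover have "mset (map ?g xs) = mset (map (blk S) [1..<Suc n])"
    proof -
      have "mset xs = mset [1..<Suc n]" using xs mset_upt by (metis mset_set_set)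
      then have "mset (map ?g xs) = mset (map ?g [1..<Suc n])" by (metis mset_map)
      also have "map ?g [1..<Suc n] = w" using lw by (intro nth_equalityI) auto
      finally show ?thesis using w mset_upt by simp
    qed
    \<comment> \<open>Both lists are sorted and have the same multiset of entries.\<close>
    ultimately have eq: "map ?g xs = map (blk S) [1..<Suc n]"
      by (metis properties_for_sort)
    have wb: "w ! (\<sigma> (Suc i) - 1) = blk S (Suc i)" if "i < n" for i
      using arg_cong[OF eq, of "\<lambda>l. l ! i"] that xs sn by simp
    have "block_word n S \<sigma> = w"
    proof (rule nth_equalityI)
      fix i assume "i < length (block_word n S \<sigma>)"
      then have i: "i < n" by simp
      have "inv \<sigma> (Suc i) \<in> {1..n}" using i permutes_in_image[OF permutes_inv[OF s], of "Suc i"] by simp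
      then obtain j where j: "inv \<sigma> (Suc i) = Suc j" "j < n" by (cases "inv \<sigma> (Suc i)") auto
      then have "\<sigma> (Suc j) = Suc i" using permutes_inverses[OF s] by metis
      then show "block_word n S \<sigma> ! i = w ! i"
        using nth_block_word[of "Suc i" \<sigma>] wb[OF j(2)] i j by simp
    qed (simp add: lw)
    moreover have "DES n \<sigma> \<subseteq> S"
    proof
      fix i assume "i \<in> DES n \<sigma>"
      then have i: "1 \<le> i" "i < n" and d: "\<sigma> i > \<sigma> (Suc i)" by (auto simp: DES_def)
      have "?f (xs ! (i - 1)) < ?f (xs ! i)" using srt i xs by (simp add: sorted_wrt_iff_nth_less)
      then have "?f (\<sigma> i) < ?f (\<sigma> (Suc i))" using sn[of i] sn[of "i - 1"] i by simp
      moreover have "\<sigma> i \<in> {1..n}" "\<sigma> (Suc i) \<in> {1..n}" using i permutes_in_image[OF s] by auto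
      \<comment> \<open>The key increases while the values decrease, so the letters must increase
        and the block number jumps at \<open>i\<close>.\<close>
      ultimately have "w ! (\<sigma> i - 1) < w ! (\<sigma> (Suc i) - 1)" using d by (auto simp: word_key_less)
      then have "blk S i < blk S (Suc i)" using wb[of i] wb[of "i - 1"] i by simp
      then show "i \<in> S" by (rule blk_SucD)
    qed
    ultimately show "w \<in> block_word n S ` ?C" using s by blast
  qed
qed

lemma sum_inv_eq_sum_imaj_subset:
  fixes q :: real
  assumes q: "0 < q" "q < 1"
  shows "(\<Sum>\<sigma> | \<sigma> permutes {1..n} \<and> DES n \<sigma> \<subseteq> S. q ^ inversion_number n \<sigma>) =
    (\<Sum>\<sigma> | \<sigma> permutes {1..n} \<and> DES n \<sigma> \<subseteq> S. q ^ maj n (inv \<sigma>))"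
proof -
  let ?C = "{\<sigma>. \<sigma> permutes {1..n} \<and> DES n \<sigma> \<subseteq> S}"
  let ?A = "image_mset (blk S) (mset_set {1..n})"
  have "(\<Sum>\<sigma>\<in>?C. q ^ inversion_number n \<sigma>) = (\<Sum>\<sigma>\<in>?C. q ^ linv (block_word n S \<sigma>))"
    by (rule sum.cong) (auto simp: linv_block_word)
  also have "\<dots> = (\<Sum>w\<in>permutations_of_multiset ?A. q ^ linv w)"
    by (rule sum.reindex_bij_betw[OF bij_betw_block_word])
  also have "\<dots> = (\<Sum>w\<in>permutations_of_multiset ?A. q ^ lmaj w)"
    by (simp only: sum_linv[OF q] sum_lmaj[OF q])
  also have "\<dots> = (\<Sum>\<sigma>\<in>?C. q ^ lmaj (block_word n S \<sigma>))"
    by (rule sum.reindex_bij_betw[OF bij_betw_block_word, symmetric])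
  also have "\<dots> = (\<Sum>\<sigma>\<in>?C. q ^ maj n (inv \<sigma>))"
    by (rule sum.cong) (auto simp: lmaj_block_word)
  finally show ?thesis .
qed

end

section \<open>From bounded descent sets to exact ones\<close>

lemma eq_by_subset_sums:
  fixes f g :: "'a set \<Rightarrow> 'b::ab_group_add"
  assumes fin: "finite U" and eq: "\<And>S. S \<subseteq> U \<Longrightarrow> (\<Sum>T\<in>Pow S. f T) = (\<Sum>T\<in>Pow S. g T)"
    and "S \<subseteq> U"
  shows "f S = g S"
  using \<open>S \<subseteq> U\<close>
proof (induction "card S" arbitrary: S rule: less_induct)
  case less
  then have fS: "finite S" using finite_subset[OF _ fin] by simp
  have split: "(\<Sum>T\<in>Pow S. h T) = h S + (\<Sum>T\<in>Pow S - {S}. h T)" for h :: "'a set \<Rightarrow> 'b"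
    using fS by (intro sum.remove) auto
  have "(\<Sum>T\<in>Pow S - {S}. f T) = (\<Sum>T\<in>Pow S - {S}. g T)"
  proof (rule sum.cong[OF refl])
    fix T assume "T \<in> Pow S - {S}"
    then show "f T = g T" using less fS by (intro less(1)) (auto intro: psubset_card_mono)
  qed
  then show ?case using eq[OF less(2)] unfolding split by simp
qed

text \<open>Equality holds for each single descent set, hence for any condition \<open>P\<close>
  expressible through the descent set.\<close>

lemma sum_inv_eq_sum_imaj:
  fixes q :: real
  assumes q: "0 < q" "q < 1"
  shows "(\<Sum>\<sigma> | \<sigma> permutes {1..n} \<and> P (DES n \<sigma>). q ^ inversion_number n \<sigma>) =
    (\<Sum>\<sigma> | \<sigma> permutes {1..n} \<and> P (DES n \<sigma>). q ^ maj n (inv \<sigma>))"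
proof -
  let ?U = "{1..n-1}"
  have fin: "finite {\<sigma>. \<sigma> permutes {1..n}}" by (simp add: finite_permutations)
  have sub: "DES n \<sigma> \<subseteq> ?U" for \<sigma> by (auto simp: DES_def)
  have group: "(\<Sum>\<sigma> | \<sigma> permutes {1..n} \<and> DES n \<sigma> \<in> X. h \<sigma>) =
      (\<Sum>T\<in>X. \<Sum>\<sigma> | \<sigma> permutes {1..n} \<and> DES n \<sigma> = T. h \<sigma>)"
    if "finite X" for X and h :: "(nat \<Rightarrow> nat) \<Rightarrow> real"
  proof -
    let ?C = "{\<sigma>. \<sigma> permutes {1..n} \<and> DES n \<sigma> \<in> X}"
    have "(\<Sum>\<sigma>\<in>?C. h \<sigma>) = (\<Sum>T\<in>X. \<Sum>\<sigma> | \<sigma> \<in> ?C \<and> DES n \<sigma> = T. h \<sigma>)"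
      by (rule sum.group[symmetric]) (use fin that in auto)
    also have "\<dots> = (\<Sum>T\<in>X. \<Sum>\<sigma> | \<sigma> permutes {1..n} \<and> DES n \<sigma> = T. h \<sigma>)"
      by (intro sum.cong refl) auto
    finally show ?thesis .
  qed
  have eq: "(\<Sum>\<sigma> | \<sigma> permutes {1..n} \<and> DES n \<sigma> = T. q ^ inversion_number n \<sigma>) =
    (\<Sum>\<sigma> | \<sigma> permutes {1..n} \<and> DES n \<sigma> = T. q ^ maj n (inv \<sigma>))" if "T \<subseteq> ?U" for T
  proof (rule eq_by_subset_sums[of ?U _ _ T])
    fix S assume S: "S \<subseteq> ?U"
    then have "finite (Pow S)" by (simp add: finite_subset[OF S])
    from group[OF this] show "(\<Sum>T\<in>Pow S. \<Sum>\<sigma> | \<sigma> permutes {1..n} \<and> DES n \<sigma> = T. q ^ inversion_number n \<sigma>) =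
      (\<Sum>T\<in>Pow S. \<Sum>\<sigma> | \<sigma> permutes {1..n} \<and> DES n \<sigma> = T. q ^ maj n (inv \<sigma>))"
      using sum_inv_eq_sum_imaj_subset[OF S q] by simp
  qed (use that in auto)
  have "{\<sigma>. \<sigma> permutes {1..n} \<and> P (DES n \<sigma>)} = {\<sigma>. \<sigma> permutes {1..n} \<and> DES n \<sigma> \<in> {T\<in>Pow ?U. P T}}"
    using sub by auto
  then show ?thesis
    using group[of "{T\<in>Pow ?U. P T}"] eq by simp
qed

text \<open>Membership depends on the descent set alone, which is what makes
  \<open>sum_inv_eq_sum_imaj\<close> applicable.\<close>

lemma Gamma_set_conv_DES:
  "Gamma_set n k = {\<sigma>. \<sigma> permutes {1..n} \<and>
     (\<forall>i. \<not> (i \<in> DES n \<sigma> \<and> Suc i \<in> DES n \<sigma>)) \<and> n - 1 \<notin> DES n \<sigma> \<and> card (DES n \<sigma>) = k}"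
proof -
  have "double_descent n \<sigma> i \<longleftrightarrow> i \<in> DES n \<sigma> \<and> Suc i \<in> DES n \<sigma>" for \<sigma> i
    by (auto simp: double_descent_def DES_def)
  moreover have "has_final_descent n \<sigma> \<longleftrightarrow> n - 1 \<in> DES n \<sigma>" for \<sigma>
    by (cases "n \<ge> 2") (auto simp: has_final_descent_def DES_def)
  ultimately show ?thesis by (simp add: Gamma_set_def des_def)
qed

lemma sum_Gamma_inv_eq_imaj:
  fixes q :: real
  assumes q: "0 < q" "q < 1"
  shows "(\<Sum>\<sigma>\<in>Gamma_set n k. q ^ inversion_number n \<sigma>) = (\<Sum>\<sigma>\<in>Gamma_set n k. q ^ maj n (inv \<sigma>))"
  unfolding Gamma_set_conv_DES
  by (rule sum_inv_eq_sum_imaj[OF q, of n "\<lambda>D. (\<forall>i. \<not> (i \<in> D \<and> Suc i \<in> D)) \<and> n - 1 \<notin> D \<and> card D = k"])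

section \<open>Permutations without double or final descents\<close>

text \<open>No double descents and no final descent: every descent is followed by an ascent.\<close>

fun tame :: "nat list \<Rightarrow> bool" where
  "tame (x # y # zs) \<longleftrightarrow> (x > y \<longrightarrow> zs \<noteq> [] \<and> y < hd zs) \<and> tame (y # zs)"
| "tame xs \<longleftrightarrow> True"

fun ldes :: "nat list \<Rightarrow> nat" where
  "ldes (x # y # zs) = (if x > y then 1 else 0) + ldes (y # zs)"
| "ldes xs = 0"

text \<open>A final descent of \<open>L\<close> would continue down to \<open>m\<close> and become a
  double descent, so \<open>L\<close> must itself be tame. If \<open>L\<close> is nonempty its last
  letter descends to \<open>m\<close>, and only a nonempty \<open>R\<close> provides the ascent that
  has to follow.\<close>

lemma tame_append_min:
  assumes "\<forall>x\<in>set L \<union> set R. m < x"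
  shows "tame (L @ m # R) \<longleftrightarrow> tame L \<and> tame R \<and> (L \<noteq> [] \<longrightarrow> R \<noteq> [])"
  using assms
proof (induction L rule: tame.induct)
  case (1 x y zs)
  then show ?case by (cases zs) auto
next
  case "2_1"
  then show ?case by (cases R rule: tame.cases) auto
next
  case ("2_2" x)
  then show ?case by (cases R rule: tame.cases) auto
qed

lemma ldes_append_min:
  assumes "\<forall>x\<in>set L \<union> set R. m < x"
  shows "ldes (L @ m # R) = ldes L + ldes R + (if L = [] then 0 else 1)"
  using assms
proof (induction L rule: ldes.induct)
  case (1 x y zs)
  then show ?case by auto
next
  case "2_1"
  then show ?case by (cases R) auto
next
  case ("2_2" x)
  then show ?case by (cases R) auto
qed

section \<open>Inversions between two sets and q-binomial coefficients\<close>

definition cross :: "nat set \<Rightarrow> nat set \<Rightarrow> nat" where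
  "cross A B = card {(a, b). a \<in> A \<and> b \<in> B \<and> b < a}"

lemma cross_insert_left:
  assumes "finite A" "finite B" "x \<notin> A"
  shows "cross (insert x A) B = card {b \<in> B. b < x} + cross A B"
proof -
  have eq: "{(a, b). a \<in> insert x A \<and> b \<in> B \<and> b < a} = Pair x ` {b \<in> B. b < x} \<union> {(a, b). a \<in> A \<and> b \<in> B \<and> b < a}"
    by auto
  have fin: "finite {(a, b). a \<in> A \<and> b \<in> B \<and> b < a}"
    by (rule finite_subset[of _ "A \<times> B"]) (use assms in auto)
  have "card (Pair x ` {b \<in> B. b < x} \<union> {(a, b). a \<in> A \<and> b \<in> B \<and> b < a}) =
    card (Pair x ` {b \<in> B. b < x}) + card {(a, b). a \<in> A \<and> b \<in> B \<and> b < a}"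
    by (rule card_Un_disjoint) (use assms fin in auto)
  then show ?thesis unfolding cross_def eq by (simp add: card_image inj_on_def)
qed

lemma linv_append:
  "distinct L \<Longrightarrow> distinct R \<Longrightarrow> linv (L @ R) = linv L + linv R + cross (set L) (set R)"
proof (induction L)
  case Nil
  then show ?case by (simp add: cross_def)
next
  case (Cons x L)
  have "length (filter (\<lambda>y. y < x) R) = card {b \<in> set R. b < x}"
    using Cons.prems by (simp add: distinct_card[symmetric])
  moreover have "cross (set (x # L)) (set R) = card {b \<in> set R. b < x} + cross (set L) (set R)"
    using Cons.prems by (simp add: cross_insert_left)
  ultimately show ?case using Cons by simp
qed

lemma linv_append_min:
  assumes "\<forall>x\<in>set L \<union> set R. m < x" "distinct L" "distinct R"
  shows "linv (L @ m # R) = linv L + linv R + length L + cross (set L) (set R)"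
proof -
  have "\<not> y < m" if "y \<in> set R" for y using assms(1) that by (metis UnI2 less_asym)
  then have "filter (\<lambda>y. y < m) R = []" by (simp add: filter_empty_conv)
  then have 1: "linv (m # R) = linv R" by simp
  have m: "m \<notin> set R" "m \<notin> set L" using assms(1) by auto
  have eq: "{(a, b). a \<in> set L \<and> b \<in> insert m (set R) \<and> b < a} =
      (\<lambda>a. (a, m)) ` set L \<union> {(a, b). a \<in> set L \<and> b \<in> set R \<and> b < a}" using assms(1) by auto
  have fin: "finite {(a, b). a \<in> set L \<and> b \<in> set R \<and> b < a}"
    by (rule finite_subset[of _ "set L \<times> set R"]) auto
  have "card ((\<lambda>a. (a, m)) ` set L \<union> {(a, b). a \<in> set L \<and> b \<in> set R \<and> b < a}) =
    card ((\<lambda>a. (a, m)) ` set L) + card {(a, b). a \<in> set L \<and> b \<in> set R \<and> b < a}"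
    by (rule card_Un_disjoint) (use fin m in auto)
  then have "cross (set L) (set (m # R)) = length L + cross (set L) (set R)"
    unfolding cross_def list.set eq using assms(2) by (simp add: card_image inj_on_def distinct_card)
  then show ?thesis using linv_append[of L "m # R"] assms m 1 by simp
qed

definition qbin :: "real \<Rightarrow> nat \<Rightarrow> nat \<Rightarrow> real" where
  "qbin q n k = qpoch q n / (qpoch q k * qpoch q (n - k))"

text \<open>The q-Pascal rule in the form that arises from adjoining a new largest element.\<close>

lemma qbin_Suc_Suc:
  assumes q: "0 < q" "q < 1" and k: "k < n"
  shows "qbin q (Suc n) (Suc k) = qbin q n (Suc k) + q ^ (n - k) * qbin q n k"
proof -
  obtain j where n: "n = Suc (k + j)" using k less_imp_Suc_add by blast
  have nz: "qpoch q i \<noteq> 0" for i using qpoch_pos[OF q, of i] by simp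
  have z: "1 - q * q ^ k \<noteq> 0" "1 - q * q ^ j \<noteq> 0"
    using pow_less_one[OF q, of "Suc k"] pow_less_one[OF q, of "Suc j"] by auto
  show ?thesis
    using nz[of k] nz[of j] z
    by (simp add: qbin_def n qpoch_Suc power_add divide_simps) (simp add: algebra_simps)
qed

text \<open>Split by whether the largest element \<open>y\<close> lies in \<open>L\<close>. If it
  does, it is inverted with every element outside \<open>L\<close>, which gives the power of
  \<open>q\<close> in the q-Pascal rule; otherwise it contributes nothing.\<close>

lemma sum_cross:
  assumes q: "0 < q" "q < 1" and "finite Z"
  shows "(\<Sum>L | L \<subseteq> Z \<and> card L = k. q ^ cross L (Z - L)) = (if k \<le> card Z then qbin q (card Z) k else 0)"
  using assms(3)
proof (induction Z arbitrary: k rule: finite_linorder_max_induct)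
  case empty
  have eq: "{L. L \<subseteq> {} \<and> card L = k} = (if k = 0 then {{}} else {})" by auto
  show ?case unfolding eq by (simp add: cross_def qbin_def)
next
  case (insert y Z)
  have y: "y \<notin> Z" using insert by auto
  have nz: "qpoch q i \<noteq> 0" for i using qpoch_pos[OF q, of i] by simp
  have qbin1: "qbin q n 0 = 1" "qbin q n n = 1" for n by (simp_all add: qbin_def nz)
  let ?F = "\<lambda>Z k. \<Sum>L | L \<subseteq> Z \<and> card L = k. q ^ cross L (Z - L)"
  have finL: "finite L" if "L \<subseteq> Z" for L using finite_subset[OF that insert(1)] .
  have out: "cross L (insert y Z - L) = cross L (Z - L)" if "L \<subseteq> Z" for L
  proof -
    have "{(a, b). a \<in> L \<and> b \<in> insert y Z - L \<and> b < a} = {(a, b). a \<in> L \<and> b \<in> Z - L \<and> b < a}"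
      using that insert(2) by (auto dest: less_trans)
    then show ?thesis by (simp add: cross_def)
  qed
  have into: "cross (insert y L) (insert y Z - insert y L) = (card Z - card L) + cross L (Z - L)" if "L \<subseteq> Z" for L
  proof -
    have "insert y Z - insert y L = Z - L" using y that by auto
    moreover have "{b \<in> Z - L. b < y} = Z - L" using insert(2) by auto
    moreover have "cross (insert y L) (Z - L) = card {b \<in> Z - L. b < y} + cross L (Z - L)"
      by (rule cross_insert_left) (use y that finL[OF that] insert(1) in auto)
    ultimately show ?thesis by (simp only: card_Diff_subset[OF finL[OF that] that])
  qed
  have rec0: "?F (insert y Z) k = (\<Sum>L | L \<subseteq> Z \<and> card L = k. q ^ cross L (insert y Z - L)) +
      (\<Sum>L | L \<subseteq> insert y Z \<and> card L = k \<and> y \<in> L. q ^ cross L (insert y Z - L))"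
  proof -
    have "{L. L \<subseteq> insert y Z \<and> card L = k} = {L. L \<subseteq> Z \<and> card L = k} \<union> {L. L \<subseteq> insert y Z \<and> card L = k \<and> y \<in> L}"
      using y by auto
    moreover have "finite {L. L \<subseteq> Z \<and> card L = k}" "finite {L. L \<subseteq> insert y Z \<and> card L = k \<and> y \<in> L}"
      by (rule finite_subset[of _ "Pow (insert y Z)"]; use insert(1) in auto)+
    moreover have "{L. L \<subseteq> Z \<and> card L = k} \<inter> {L. L \<subseteq> insert y Z \<and> card L = k \<and> y \<in> L} = {}" using y by auto
    ultimately show ?thesis by (simp only: sum.union_disjoint)
  qed
  have first: "(\<Sum>L | L \<subseteq> Z \<and> card L = k. q ^ cross L (insert y Z - L)) = ?F Z k"
    by (rule sum.cong) (auto simp: out)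
  show ?case
  proof (cases k)
    case 0
    have "{L. L \<subseteq> insert y Z \<and> card L = 0} = {{}}"
      using finite_subset[of _ "insert y Z"] insert(1) by auto
    then show ?thesis using 0 by (simp add: cross_def qbin1)
  next
    case (Suc k')
    have second: "(\<Sum>L | L \<subseteq> insert y Z \<and> card L = k \<and> y \<in> L. q ^ cross L (insert y Z - L)) =
      (\<Sum>L | L \<subseteq> Z \<and> card L = k'. q ^ (card Z - k') * q ^ cross L (Z - L))"
    proof (rule sum.reindex_bij_witness[where i = "insert y" and j = "\<lambda>L. L - {y}"])
      fix L assume L: "L \<in> {L. L \<subseteq> insert y Z \<and> card L = k \<and> y \<in> L}"
      then show i: "insert y (L - {y}) = L" by auto
      have "finite L" using L finite_subset[of L "insert y Z"] insert(1) by auto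
      then show j: "L - {y} \<in> {L. L \<subseteq> Z \<and> card L = k'}" using L Suc by auto
      then show "q ^ (card Z - k') * q ^ cross (L - {y}) (Z - (L - {y})) = q ^ cross L (insert y Z - L)"
        using into[of "L - {y}"] unfolding i by (simp add: power_add)
    next
      fix L assume L: "L \<in> {L. L \<subseteq> Z \<and> card L = k'}"
      then have "y \<notin> L" using y by auto
      then show "insert y L - {y} = L" by auto
      show "insert y L \<in> {L. L \<subseteq> insert y Z \<and> card L = k \<and> y \<in> L}"
        using L Suc finL[of L] \<open>y \<notin> L\<close> by auto
    qed
    have "?F (insert y Z) k = ?F Z k + q ^ (card Z - k') * ?F Z k'"
      unfolding rec0 first second by (simp add: sum_distrib_left)
    also have "\<dots> = (if k \<le> card (insert y Z) then qbin q (card (insert y Z)) k else 0)"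
    proof (cases "k' < card Z")
      case True
      then show ?thesis using qbin_Suc_Suc[OF q True] Suc insert y by simp
    next
      case False
      then show ?thesis using Suc insert y by (auto simp: qbin1)
    qed
    finally show ?thesis .
  qed
qed

section \<open>The recursion at the smallest letter\<close>

definition tame_lists :: "nat set \<Rightarrow> nat list set" where
  "tame_lists Z = {xs \<in> permutations_of_set Z. tame xs}"

lemma finite_tame_lists [simp]: "finite (tame_lists Z)"
  by (simp add: tame_lists_def)

definition tame_sum :: "real \<Rightarrow> real \<Rightarrow> nat set \<Rightarrow> real" where
  "tame_sum q x Z = (\<Sum>xs\<in>tame_lists Z. q ^ linv xs * x ^ ldes xs)"

lemma tame_lists_empty: "tame_lists {} = {[]}"
  by (auto simp: tame_lists_def)

lemma tame_sum_empty [simp]: "tame_sum q x {} = 1"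
  by (simp add: tame_sum_def tame_lists_empty)

text \<open>\<open>A\<close> is the set of letters to the left of \<open>m\<close>. For
  \<open>A = {}\<close> no descent is created, which gives the first summand. A nonempty
  \<open>A = Z\<close> would leave \<open>m\<close> at the end after a descent. Every other
  \<open>A\<close> costs one descent into \<open>m\<close>, hence the factor
  \<open>x\<close>.\<close>

lemma tame_sum_insert_min:
  assumes Z: "finite Z" "\<forall>z\<in>Z. m < z"
  shows "tame_sum q x (insert m Z) = tame_sum q x Z +
    x * (\<Sum>A\<in>Pow Z - {{}, Z}. q ^ (card A + cross A (Z - A)) * (tame_sum q x A * tame_sum q x (Z - A)))"
proof -
  have m: "m \<notin> Z" using Z(2) by auto
  let ?w = "\<lambda>xs. q ^ linv xs * x ^ ldes xs"
  let ?AA = "insert {} (Pow Z - {{}, Z})"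
  have min: "\<forall>y\<in>set L \<union> set R. m < y" if "L \<in> tame_lists A" "R \<in> tame_lists (Z - A)" "A \<subseteq> Z" for L R A
    using that Z(2) by (auto simp: tame_lists_def permutations_of_set_def)
  have "tame_sum q x (insert m Z) = (\<Sum>(A, L, R)\<in>Sigma ?AA (\<lambda>A. tame_lists A \<times> tame_lists (Z - A)). ?w (L @ m # R))"
    unfolding tame_sum_def
  proof (rule sum.reindex_bij_witness[where i = "\<lambda>(A, L, R). L @ m # R" and
      j = "\<lambda>xs. (set (takeWhile (\<lambda>y. y \<noteq> m) xs), takeWhile (\<lambda>y. y \<noteq> m) xs, tl (dropWhile (\<lambda>y. y \<noteq> m) xs))"], goal_cases)
    case (1 xs)
    then have "m \<in> set xs" by (auto simp: tame_lists_def permutations_of_set_def)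
    then obtain L R where xs: "xs = L @ m # R" "m \<notin> set L" by (meson split_list_first)
    then have "takeWhile (\<lambda>y. y \<noteq> m) xs = L" "dropWhile (\<lambda>y. y \<noteq> m) xs = m # R"
      by (auto simp: takeWhile_append dropWhile_append)
    then show ?case using xs by simp
  next
    case (2 xs)
    then have "m \<in> set xs" by (auto simp: tame_lists_def permutations_of_set_def)
    then obtain L R where xs: "xs = L @ m # R" "m \<notin> set L" by (meson split_list_first)
    then have tw: "takeWhile (\<lambda>y. y \<noteq> m) xs = L" "dropWhile (\<lambda>y. y \<noteq> m) xs = m # R"
      by (auto simp: takeWhile_append dropWhile_append)
    have p: "set L \<union> insert m (set R) = insert m Z" "distinct L" "distinct R" "m \<notin> set R" "set L \<inter> set R = {}" "tame (L @ m # R)"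
      using 2 xs by (auto simp: tame_lists_def permutations_of_set_def)
    have LR: "set L \<union> set R = Z" using p xs(2) m by (metis Un_insert_right insert_ident Un_iff)
    then have R: "set R = Z - set L" using p by auto
    have "tame L" "tame R" "L \<noteq> [] \<longrightarrow> R \<noteq> []"
      using tame_append_min[of L R m] p(6) Z(2) unfolding LR by auto
    moreover have "set L \<in> ?AA" using LR R calculation(3) by auto
    ultimately show ?case using p R tw by (simp add: tame_lists_def permutations_of_set_def)
  next
    case (3 a)
    obtain A L R where a: "a = (A, L, R)" by (cases a)
    then have A: "A \<subseteq> Z" and L: "L \<in> tame_lists A" "R \<in> tame_lists (Z - A)" using 3 by auto
    have "m \<notin> set L" using A L m by (auto simp: tame_lists_def permutations_of_set_def)
    moreover have "set L = A" using L by (simp add: tame_lists_def permutations_of_set_def)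
    ultimately show ?case by (auto simp: a takeWhile_append dropWhile_append)
  next
    case (4 a)
    obtain A L R where a: "a = (A, L, R)" by (cases a)
    then have A: "A \<subseteq> Z" "A \<noteq> {} \<longrightarrow> A \<noteq> Z" and L: "L \<in> tame_lists A" "R \<in> tame_lists (Z - A)" using 4 by auto
    have p: "set L = A" "set R = Z - A" "distinct L" "distinct R" "tame L" "tame R"
      using L by (auto simp: tame_lists_def permutations_of_set_def)
    have "tame (L @ m # R)" using tame_append_min[OF min[OF L A(1)]] p A by auto
    then show ?case using p A m by (auto simp: a tame_lists_def permutations_of_set_def)
  next
    case (5 xs)
    then have "m \<in> set xs" by (auto simp: tame_lists_def permutations_of_set_def)
    then obtain L R where xs: "xs = L @ m # R" "m \<notin> set L" by (meson split_list_first)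
    then have "takeWhile (\<lambda>y. y \<noteq> m) xs = L" "dropWhile (\<lambda>y. y \<noteq> m) xs = m # R"
      by (auto simp: takeWhile_append dropWhile_append)
    then show ?case using xs by simp
  qed
  also have "\<dots> = (\<Sum>A\<in>?AA. \<Sum>(L, R)\<in>tame_lists A \<times> tame_lists (Z - A). ?w (L @ m # R))"
    by (subst sum.Sigma) (use Z in auto)
  also have "\<dots> = (\<Sum>A\<in>?AA. (if A = {} then 1 else x) * (q ^ (card A + cross A (Z - A)) * (tame_sum q x A * tame_sum q x (Z - A))))"
  proof (rule sum.cong[OF refl])
    fix A assume "A \<in> ?AA"
    then have A: "A \<subseteq> Z" by auto
    let ?c = "(if A = {} then 1 else x) * q ^ (card A + cross A (Z - A))"
    have "(\<Sum>(L, R)\<in>tame_lists A \<times> tame_lists (Z - A). ?w (L @ m # R)) =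
      (\<Sum>(L, R)\<in>tame_lists A \<times> tame_lists (Z - A). ?c * (?w L * ?w R))"
    proof (rule sum.cong[OF refl], clarify)
      fix L R assume L: "L \<in> tame_lists A" "R \<in> tame_lists (Z - A)"
      have p: "set L = A" "set R = Z - A" "distinct L" "distinct R"
        using L by (auto simp: tame_lists_def permutations_of_set_def)
      have l: "length L = card A" using p distinct_card by metis
      note mn = min[OF L A]
      have "L = [] \<longleftrightarrow> A = {}" using p by auto
      then show "?w (L @ m # R) = ?c * (?w L * ?w R)"
        unfolding linv_append_min[OF mn p(3,4)] ldes_append_min[OF mn] p(1,2) l
        by (simp add: power_add mult_ac)
    qed
    also have "\<dots> = ?c * (tame_sum q x A * tame_sum q x (Z - A))"
    proof -
      have "tame_sum q x A * tame_sum q x (Z - A) = (\<Sum>(L, R)\<in>tame_lists A \<times> tame_lists (Z - A). ?w L * ?w R)"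
        by (simp only: tame_sum_def sum_product sum.cartesian_product)
      then show ?thesis by (simp only: sum_distrib_left case_prod_unfold)
    qed
    finally show "(\<Sum>(L, R)\<in>tame_lists A \<times> tame_lists (Z - A). ?w (L @ m # R)) =
      (if A = {} then 1 else x) * (q ^ (card A + cross A (Z - A)) * (tame_sum q x A * tame_sum q x (Z - A)))"
      by (simp only: mult.assoc)
  qed
  also have "\<dots> = tame_sum q x Z + (\<Sum>A\<in>Pow Z - {{}, Z}. x * (q ^ (card A + cross A (Z - A)) * (tame_sum q x A * tame_sum q x (Z - A))))"
  proof (subst sum.insert)
    show "finite (Pow Z - {{}, Z})" using Z by simp
    show "{} \<notin> Pow Z - {{}, Z}" by simp
    have "cross {} Z = 0" by (simp add: cross_def)
    moreover have "(\<Sum>A\<in>Pow Z - {{}, Z}. (if A = {} then 1 else x) * (q ^ (card A + cross A (Z - A)) * (tame_sum q x A * tame_sum q x (Z - A)))) =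
      (\<Sum>A\<in>Pow Z - {{}, Z}. x * (q ^ (card A + cross A (Z - A)) * (tame_sum q x A * tame_sum q x (Z - A))))"
      by (rule sum.cong) auto
    ultimately show "(if ({}::nat set) = {} then 1 else x) * (q ^ (card {} + cross {} (Z - {})) * (tame_sum q x {} * tame_sum q x (Z - {}))) +
      (\<Sum>A\<in>Pow Z - {{}, Z}. (if A = {} then 1 else x) * (q ^ (card A + cross A (Z - A)) * (tame_sum q x A * tame_sum q x (Z - A)))) =
      tame_sum q x Z + (\<Sum>A\<in>Pow Z - {{}, Z}. x * (q ^ (card A + cross A (Z - A)) * (tame_sum q x A * tame_sum q x (Z - A))))"
      by simp
  qed
  finally show ?thesis by (simp only: sum_distrib_left)
qed

text \<open>Grouping the sets \<open>A\<close> by size turns the crossing inversions into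
  \<open>qbin\<close>. \<open>IH\<close> is a premise because it is supplied in two ways: by the
  induction hypothesis inside \<open>tame_sum_card\<close>, and by that lemma itself in
  \<open>tame_sum_Suc\<close>.\<close>

lemma tame_sum_insert_min_card:
  assumes q: "0 < q" "q < 1"
    and Z: "finite Z" "\<forall>z\<in>Z. m < z" "card Z = n"
    and IH: "\<And>A. finite A \<Longrightarrow> card A \<le> n \<Longrightarrow> tame_sum q x A = tame_sum q x {1..card A}"
  shows "tame_sum q x (insert m Z) = tame_sum q x {1..n} +
      x * (\<Sum>k\<in>{1..<n}. qbin q n k * q ^ k * (tame_sum q x {1..k} * tame_sum q x {1..n - k}))"
proof -
  let ?T = "\<lambda>k. tame_sum q x {1..k}"
  have "(\<Sum>A\<in>Pow Z - {{}, Z}. q ^ (card A + cross A (Z - A)) * (tame_sum q x A * tame_sum q x (Z - A))) =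
    (\<Sum>A\<in>Pow Z - {{}, Z}. q ^ card A * (?T (card A) * ?T (n - card A)) * q ^ cross A (Z - A))"
  proof (rule sum.cong[OF refl])
    fix A assume "A \<in> Pow Z - {{}, Z}"
    then have A: "A \<subseteq> Z" "finite A" using finite_subset[OF _ Z(1)] by auto
    have "card (Z - A) = n - card A" using A Z by (simp add: card_Diff_subset)
    then show "q ^ (card A + cross A (Z - A)) * (tame_sum q x A * tame_sum q x (Z - A)) =
      q ^ card A * (?T (card A) * ?T (n - card A)) * q ^ cross A (Z - A)"
      using IH[of A] IH[of "Z - A"] A Z card_mono[OF Z(1) A(1)] by (simp add: power_add)
  qed
  also have "\<dots> = (\<Sum>k\<in>{1..<n}. \<Sum>A\<in>{A \<in> Pow Z - {{}, Z}. card A = k}. q ^ card A * (?T (card A) * ?T (n - card A)) * q ^ cross A (Z - A))"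
  proof (rule sum.group[symmetric])
    show "card ` (Pow Z - {{}, Z}) \<subseteq> {1..<n}"
    proof (rule image_subsetI)
      fix A assume "A \<in> Pow Z - {{}, Z}"
      then have A: "A \<subseteq> Z" "A \<noteq> {}" "A \<noteq> Z" by auto
      then have "finite A" using finite_subset[OF _ Z(1)] by auto
      then have "card A > 0" using A by (simp add: card_gt_0_iff)
      moreover have "card A < n" unfolding Z(3)[symmetric] by (rule psubset_card_mono) (use A Z in auto)
      ultimately show "card A \<in> {1..<n}" by simp
    qed
  qed (use Z in auto)
  also have "\<dots> = (\<Sum>k\<in>{1..<n}. qbin q n k * q ^ k * (?T k * ?T (n - k)))"
  proof (rule sum.cong[OF refl])
    fix k assume k: "k \<in> {1..<n}"
    have eq: "{A \<in> Pow Z - {{}, Z}. card A = k} = {A. A \<subseteq> Z \<and> card A = k}" using k Z by auto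
    have "(\<Sum>A\<in>{A \<in> Pow Z - {{}, Z}. card A = k}. q ^ card A * (?T (card A) * ?T (n - card A)) * q ^ cross A (Z - A)) =
      q ^ k * (?T k * ?T (n - k)) * (\<Sum>A | A \<subseteq> Z \<and> card A = k. q ^ cross A (Z - A))"
      unfolding eq sum_distrib_left by (rule sum.cong) auto
    also have "(\<Sum>A | A \<subseteq> Z \<and> card A = k. q ^ cross A (Z - A)) = qbin q n k"
      using sum_cross[OF q Z(1), of k] k Z by simp
    finally show "(\<Sum>A\<in>{A \<in> Pow Z - {{}, Z}. card A = k}. q ^ card A * (?T (card A) * ?T (n - card A)) * q ^ cross A (Z - A)) =
      qbin q n k * q ^ k * (?T k * ?T (n - k))" by (simp add: mult_ac)
  qed
  finally show ?thesis
    unfolding tame_sum_insert_min[OF Z(1,2)] using IH[of Z] Z by simp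
qed

text \<open>Invariance under relabelling without any relabelling map: the recursion at the minimum
  depends on the set only through its size.\<close>

lemma tame_sum_card:
  assumes q: "0 < q" "q < 1" and "finite Z"
  shows "tame_sum q x Z = tame_sum q x {1..card Z}"
  using assms(3)
proof (induction "card Z" arbitrary: Z rule: less_induct)
  case less
  show ?case
  proof (cases "card Z")
    case 0
    then show ?thesis using less by simp
  next
    case (Suc n)
    then have "Z \<noteq> {}" by auto
    define m where "m = Min Z"
    have m: "m \<in> Z" using less \<open>Z \<noteq> {}\<close> by (simp add: m_def)
    have mn: "\<forall>z\<in>Z - {m}. m < z"
      using Min_le[OF less(2)] by (auto simp: m_def le_less)
    have IH: "tame_sum q x A = tame_sum q x {1..card A}" if "finite A" "card A \<le> n" for A
      using less(1)[of A] that Suc by simp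
    have "tame_sum q x (insert m (Z - {m})) = tame_sum q x (insert 1 {2..Suc n})"
      using tame_sum_insert_min_card[OF q _ mn _ IH] tame_sum_insert_min_card[OF q, of "{2..Suc n}" 1 n, OF _ _ _ IH] less(2) Suc m by simp
    moreover have "insert m (Z - {m}) = Z" "insert 1 {2..Suc n} = {1..Suc n}" using m by auto
    ultimately show ?thesis by (simp only: Suc)
  qed
qed

lemma tame_sum_Suc:
  assumes q: "0 < q" "q < 1"
  shows "tame_sum q x {1..Suc n} = tame_sum q x {1..n} +
    x * (\<Sum>k\<in>{1..<n}. qbin q n k * q ^ k * (tame_sum q x {1..k} * tame_sum q x {1..n - k}))"
proof -
  have "tame_sum q x (insert 1 {2..Suc n}) = tame_sum q x {1..n} +
      x * (\<Sum>k\<in>{1..<n}. qbin q n k * q ^ k * (tame_sum q x {1..k} * tame_sum q x {1..n - k}))"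
    by (rule tame_sum_insert_min_card[OF q _ _ _ tame_sum_card[OF q]]) auto
  moreover have "insert 1 {2..Suc n} = {1..Suc n}" by auto
  ultimately show ?thesis by simp
qed

section \<open>Excedances of injections\<close>

text \<open>
  A value at position \<open>i\<close> is barred if it exceeds \<open>i\<close>. \<open>bdesc xs i\<close> says that position \<open>i\<close> is
  a descent when all barred values are ranked below all unbarred ones.
\<close>

definition bdesc :: "nat list \<Rightarrow> nat \<Rightarrow> bool" where
  "bdesc xs i \<longleftrightarrow> (if xs ! (i - 1) > i then xs ! i > Suc i \<and> xs ! (i - 1) > xs ! i
                   else xs ! i > Suc i \<or> xs ! (i - 1) > xs ! i)"

definition lexc :: "nat list \<Rightarrow> nat" where
  "lexc xs = card {p. p < length xs \<and> xs ! p > Suc p}"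

definition wt :: "real \<Rightarrow> real \<Rightarrow> nat list \<Rightarrow> real" where
  "wt q t xs = q ^ dsum (bdesc xs) (length xs) * t ^ lexc xs"

definition inj_lists :: "nat \<Rightarrow> nat set \<Rightarrow> nat list set" where
  "inj_lists m Z = {xs. length xs = m \<and> distinct xs \<and> set xs \<subseteq> Z}"

lemma finite_inj_lists [simp]: "finite Z \<Longrightarrow> finite (inj_lists m Z)"
  by (rule finite_subset[OF _ finite_lists_length_eq[of Z m]]) (auto simp: inj_lists_def)

text \<open>Normalised as in \<open>dsum_tail_expansion\<close>, so that the sums can be matched
  with coefficients of power series.\<close>

definition Wsum :: "real \<Rightarrow> real \<Rightarrow> nat \<Rightarrow> nat set \<Rightarrow> real" where
  "Wsum q t m Z = (\<Sum>u\<in>inj_lists m Z. wt q t u) / qpoch q m"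

text \<open>
  Increasing order of this key lists the values up to \<open>n\<close> decreasingly, followed by the larger
  values, also decreasingly.
\<close>

definition tail_key :: "nat \<Rightarrow> nat \<Rightarrow> real" where
  "tail_key n v = (if v \<le> n then - real v else 1 / real v)"

lemma tail_key_less:
  "tail_key n a < tail_key n b \<longleftrightarrow> a \<le> n \<and> n < b \<or> b < a \<and> (a \<le> n \<longleftrightarrow> b \<le> n)"
proof (cases "a \<le> n"; cases "b \<le> n")
  assume "a \<le> n" "\<not> b \<le> n"
  moreover have "- real a < 1 / real b" if "\<not> b \<le> n"
    by (rule le_less_trans[of _ 0]) (use that in auto)
  ultimately show ?thesis by (simp add: tail_key_def)
next
  assume "\<not> a \<le> n" "b \<le> n"
  moreover have "\<not> 1 / real a < - real b"
    by (simp add: not_less order_trans[of _ 0])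
  ultimately show ?thesis by (simp add: tail_key_def)
next
  assume "\<not> a \<le> n" "\<not> b \<le> n"
  then show ?thesis by (auto simp: tail_key_def divide_simps)
qed (auto simp: tail_key_def)

lemma inj_tail_key: "inj_on (tail_key n) X"
proof (rule inj_onI)
  fix a b assume "tail_key n a = tail_key n b"
  then have "\<not> tail_key n a < tail_key n b" "\<not> tail_key n b < tail_key n a" by simp_all
  then show "a = b" unfolding tail_key_less by auto
qed

text \<open>A run of such descents consists of decreasing unbarred values followed by decreasing
  barred ones. A barred value at the last position \<open>n\<close> exceeds \<open>n\<close>, hence
  so do all barred values of the run; the first unbarred value is at most its position
  \<open>Suc m\<close>, hence so are the others. Conversely, from position \<open>Suc m\<close> on,
  values up to \<open>Suc m\<close> are unbarred and values beyond \<open>n\<close> are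
  barred.\<close>

lemma bdesc_tail_iff:
  assumes "m \<le> length xs" "n = length xs"
  shows "(\<forall>i. m < i \<and> i < n \<longrightarrow> bdesc xs i) \<longleftrightarrow>
    sorted_wrt (\<lambda>a b. tail_key n a < tail_key n b) (drop m xs) \<and> set (drop m xs) \<subseteq> {..Suc m} \<union> {n<..}"
  using assms(1)
proof (induction m rule: inc_induct)
  case base
  then show ?case using assms(2) by auto
next
  case (step m)
  define x where "x = xs ! m"
  have d: "drop m xs = x # drop (Suc m) xs" using step by (simp add: x_def Cons_nth_drop_Suc)
  have L: "(\<forall>i. m < i \<and> i < n \<longrightarrow> bdesc xs i) \<longleftrightarrow>
      (Suc m < n \<longrightarrow> bdesc xs (Suc m)) \<and> (\<forall>i. Suc m < i \<and> i < n \<longrightarrow> bdesc xs i)"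
    by (metis Suc_lessI lessI less_trans)
  show ?case
  proof (cases "Suc m = n")
    case True
    then have "drop (Suc m) xs = []" using assms(2) by simp
    then show ?thesis unfolding L d using True by auto
  next
    case False
    then have m: "Suc m < n" using step assms(2) by simp
    define y where "y = xs ! Suc m"
    obtain R where R: "drop (Suc m) xs = y # R" using m assms(2) by (simp add: y_def Cons_nth_drop_Suc[symmetric])
    have b: "bdesc xs (Suc m) \<longleftrightarrow> (if x > Suc m then y > Suc (Suc m) \<and> x > y else y > Suc (Suc m) \<or> x > y)"
      by (simp add: bdesc_def x_def y_def)
    let ?s = "\<lambda>xs. sorted_wrt (\<lambda>a b. tail_key n a < tail_key n b) xs"
    show ?thesis
      unfolding L step.IH d R
    proof (intro iffI)
      assume A: "(Suc m < n \<longrightarrow> bdesc xs (Suc m)) \<and> ?s (y # R) \<and> set (y # R) \<subseteq> {..Suc (Suc m)} \<union> {n<..}"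
      then have xy: "tail_key n x < tail_key n y" "x \<le> Suc m \<or> n < x"
        using m by (auto simp: b tail_key_less split: if_splits)
      have xz: "tail_key n x < tail_key n z" if "z \<in> set (y # R)" for z
        using xy(1) A that by auto
      have "z \<le> Suc m \<or> n < z" if "z \<in> set (y # R)" for z
        using xz[OF that] xy(2) by (auto simp: tail_key_less)
      then show "?s (x # y # R) \<and> set (x # y # R) \<subseteq> {..Suc m} \<union> {n<..}"
        using xz xy(2) A by auto
    next
      assume A: "?s (x # y # R) \<and> set (x # y # R) \<subseteq> {..Suc m} \<union> {n<..}"
      then have "tail_key n x < tail_key n y" "x \<le> Suc m \<or> n < x" by auto
      then have "bdesc xs (Suc m)" using m by (auto simp: b tail_key_less)
      then show "(Suc m < n \<longrightarrow> bdesc xs (Suc m)) \<and> ?s (y # R) \<and> set (y # R) \<subseteq> {..Suc (Suc m)} \<union> {n<..}"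
        using A by auto
    qed
  qed
qed

lemma bdesc_take:
  "m \<le> length xs \<Longrightarrow> dsum (bdesc xs) m = dsum (bdesc (take m xs)) (length (take m xs))"
  by (auto intro!: dsum_cong simp: bdesc_def)

lemma lexc_tail:
  assumes m: "m \<le> length xs" and n: "n = length xs" and d: "distinct xs"
    and X: "set (drop m xs) \<subseteq> {..Suc m} \<union> {n<..}"
  shows "lexc xs = lexc (take m xs) + card (set (drop m xs) \<inter> {n<..})"
proof -
  have "{p. p < length xs \<and> xs ! p > Suc p} =
    {p. p < m \<and> xs ! p > Suc p} \<union> (\<lambda>j. m + j) ` {j. j < length (drop m xs) \<and> drop m xs ! j > n}" (is "?L = ?A \<union> ?B")
  proof (intro set_eqI iffI)
    fix p assume p: "p \<in> ?L"
    show "p \<in> ?A \<union> ?B"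
    proof (cases "p < m")
      case False
      then have "xs ! p \<in> set (drop m xs)"
        using p by (metis (no_types, lifting) drop_drop in_set_dropD Cons_nth_drop_Suc le_add_diff_inverse2 list.set_intros(1) mem_Collect_eq not_less)
      then have "xs ! p > n" using X p False by auto
      then show ?thesis using p False m by (auto intro!: image_eqI[of _ _ "p - m"])
    qed (use p in auto)
  next
    fix p assume "p \<in> ?A \<union> ?B"
    then show "p \<in> ?L" using m n by auto
  qed
  moreover have "?A \<inter> ?B = {}" by auto
  moreover have "card ?B = card {j. j < length (drop m xs) \<and> drop m xs ! j > n}"
    by (rule card_image) simp
  moreover have "\<dots> = length (filter (\<lambda>v. v > n) (drop m xs))"
    by (simp add: length_filter_conv_card)
  moreover have "\<dots> = card (set (drop m xs) \<inter> {n<..})"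
    using d by (simp add: distinct_card[symmetric] Int_def conj_commute)
  moreover have "?A = {p. p < length (take m xs) \<and> take m xs ! p > Suc p}" using m by auto
  ultimately show ?thesis unfolding lexc_def
    by (simp add: card_Un_disjoint)
qed

text \<open>\<open>X\<close> is the set of values in the tail. It determines the tail, its elements
  beyond \<open>n\<close> are exactly the excedances there, and the first \<open>n - r\<close>
  positions carry an arbitrary injection avoiding \<open>X\<close>.\<close>

lemma Wsum_tail_expansion:
  assumes q: "0 < q" "q < 1" and V: "finite V" "V \<subseteq> {n<..}"
  shows "q ^ n * Wsum q t n ({1..n} \<union> V) =
    (\<Sum>r\<le>n. (-1) ^ r * (\<Sum>X | X \<subseteq> {1..Suc (n - r)} \<union> V \<and> card X = r.
        t ^ card (X \<inter> {n<..}) * Wsum q t (n - r) ({1..n} \<union> V - X)))"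
proof -
  let ?Z = "{1..n} \<union> V"
  let ?I = "inj_lists n ?Z"
  let ?tail = "\<lambda>xs r. \<forall>i. n - r < i \<and> i < n \<longrightarrow> bdesc xs i"
  let ?XX = "\<lambda>r. {X. X \<subseteq> {1..Suc (n - r)} \<union> V \<and> card X = r}"
  let ?g = "\<lambda>u X. t ^ card (X \<inter> {n<..}) * (wt q t u / qpoch q (length u))"
  have len: "length xs = n" if "xs \<in> ?I" for xs using that by (simp add: inj_lists_def)
  have finZ: "finite ?Z" using V by simp
  have finXX: "finite (?XX r)" for r
    by (rule finite_subset[of _ "Pow ({1..Suc (n - r)} \<union> V)"]) (use V in auto)
  have finX: "finite X" if "X \<in> ?XX r" for X r
    by (rule finite_subset[of X "{1..Suc (n - r)} \<union> V"]) (use that V(1) in auto)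
  have tail_iff: "?tail xs r \<longleftrightarrow> sorted_wrt (\<lambda>a b. tail_key n a < tail_key n b) (drop (n - r) xs) \<and>
      set (drop (n - r) xs) \<subseteq> {..Suc (n - r)} \<union> {n<..}" if "length xs = n" for xs r
    by (rule bdesc_tail_iff) (use that in auto)
  have step: "q ^ n * (wt q t xs / qpoch q n) = (\<Sum>r\<le>n. if ?tail xs r then (-1) ^ r * ?g (take (n - r) xs) (set (drop (n - r) xs)) else 0)"
    if xs: "xs \<in> ?I" for xs
  proof -
    have "q ^ n * (wt q t xs / qpoch q n) = t ^ lexc xs * (q ^ n * q ^ dsum (bdesc xs) n / qpoch q n)"
      by (simp add: wt_def len[OF xs])
    also have "\<dots> = (\<Sum>r\<le>n. t ^ lexc xs * (if ?tail xs r then (-1) ^ r * q ^ dsum (bdesc xs) (n - r) / qpoch q (n - r) else 0))"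
      unfolding dsum_tail_expansion[OF q] by (rule sum_distrib_left)
    also have "\<dots> = (\<Sum>r\<le>n. if ?tail xs r then (-1) ^ r * ?g (take (n - r) xs) (set (drop (n - r) xs)) else 0)"
    proof (rule sum.cong[OF refl])
      fix r assume r: "r \<in> {..n}"
      show "t ^ lexc xs * (if ?tail xs r then (-1) ^ r * q ^ dsum (bdesc xs) (n - r) / qpoch q (n - r) else 0) =
        (if ?tail xs r then (-1) ^ r * ?g (take (n - r) xs) (set (drop (n - r) xs)) else 0)"
      proof (cases "?tail xs r")
        case True
        then have X: "set (drop (n - r) xs) \<subseteq> {..Suc (n - r)} \<union> {n<..}"
          unfolding tail_iff[OF len[OF xs]] by (rule conjunct2)
        have "lexc xs = lexc (take (n - r) xs) + card (set (drop (n - r) xs) \<inter> {n<..})"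
          by (rule lexc_tail) (use X len[OF xs] xs in \<open>auto simp: inj_lists_def\<close>)
        moreover have "dsum (bdesc xs) (n - r) = dsum (bdesc (take (n - r) xs)) (length (take (n - r) xs))"
          by (rule bdesc_take) (simp add: len[OF xs])
        moreover have "length (take (n - r) xs) = n - r" using len[OF xs] by simp
        ultimately show ?thesis using True
          by (simp only: if_True wt_def power_add) simp
      next
        case False
        show ?thesis unfolding if_not_P[OF False] by simp
      qed
    qed
    finally show ?thesis .
  qed
  have inner: "(\<Sum>xs\<in>{xs\<in>?I. ?tail xs r}. ?g (take (n - r) xs) (set (drop (n - r) xs))) =
     (\<Sum>X\<in>?XX r. t ^ card (X \<inter> {n<..}) * Wsum q t (n - r) (?Z - X))" if r: "r \<le> n" for r
  proof -
    have "(\<Sum>xs\<in>{xs\<in>?I. ?tail xs r}. ?g (take (n - r) xs) (set (drop (n - r) xs))) =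
      (\<Sum>(X, u)\<in>Sigma (?XX r) (\<lambda>X. inj_lists (n - r) (?Z - X)). ?g u X)"
    proof (rule sum.reindex_bij_witness[where
          i = "\<lambda>(X, u). u @ arrange (tail_key n) X" and
          j = "\<lambda>xs. (set (drop (n - r) xs), take (n - r) xs)"], goal_cases)
      case (1 xs)
      then have "xs \<in> ?I" "?tail xs r" by blast+
      then have "sorted_wrt (\<lambda>a b. tail_key n a < tail_key n b) (drop (n - r) xs)"
        unfolding tail_iff[OF len[OF \<open>xs \<in> ?I\<close>]] by (elim conjunct1)
      from arrange_set_eq[OF this inj_tail_key] show ?case by simp
    next
      case (2 xs)
      then have "xs \<in> ?I" "?tail xs r" by blast+
      then have X: "set (drop (n - r) xs) \<subseteq> {..Suc (n - r)} \<union> {n<..}"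
        unfolding tail_iff[OF len[OF \<open>xs \<in> ?I\<close>]] by (elim conjunct2)
      have xs: "length xs = n" "distinct xs" "set xs \<subseteq> ?Z" using 2 by (auto simp: inj_lists_def)
      have "set (drop (n - r) xs) \<subseteq> {1..Suc (n - r)} \<union> V"
      proof
        fix v assume v: "v \<in> set (drop (n - r) xs)"
        then have "v \<in> ?Z" using xs(3) by (meson in_set_dropD subsetD)
        then show "v \<in> {1..Suc (n - r)} \<union> V" using v X V(2) by auto
      qed
      moreover have "card (set (drop (n - r) xs)) = r"
        using xs r by (simp add: distinct_card)
      moreover have "set (take (n - r) xs) \<subseteq> ?Z - set (drop (n - r) xs)"
        using xs set_take_disj_set_drop_if_distinct[of xs "n - r" "n - r"] set_take_subset[of "n - r" xs] by blast
      ultimately show ?case using xs r by (auto simp: inj_lists_def)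
    next
      case (3 b)
      obtain X u where b: "b = (X, u)" by (cases b)
      with 3 have X: "X \<in> ?XX r" and u: "u \<in> inj_lists (n - r) (?Z - X)" by auto
      then show ?case using set_arrange[OF finX[OF X]] by (simp add: b inj_lists_def)
    next
      case (4 b)
      obtain X u where b: "b = (X, u)" by (cases b)
      with 4 have X: "X \<in> ?XX r" and u: "u \<in> inj_lists (n - r) (?Z - X)" by auto
      note f = finX[OF X]
      \<comment> \<open>For \<open>r = 0\<close> the interval \<open>{1..Suc (n - r)}\<close> sticks
        out of \<open>{1..n}\<close>, but then \<open>X\<close> is empty.\<close>
      have XZ: "X \<subseteq> ?Z"
      proof (cases "r = 0")
        case True
        then show ?thesis using X f by simp
      next
        case False
        then have "Suc (n - r) \<le> n" using r by simp
        then show ?thesis using X by fastforce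
      qed
      have lu: "length u = n - r" using u by (simp add: inj_lists_def)
      have "length (u @ arrange (tail_key n) X) = n"
        using lu X r by (simp add: length_arrange[OF f])
      moreover have "distinct (u @ arrange (tail_key n) X)" "set (u @ arrange (tail_key n) X) \<subseteq> ?Z"
        using u XZ by (auto simp: inj_lists_def distinct_arrange[OF f] set_arrange[OF f])
      moreover have "?tail (u @ arrange (tail_key n) X) r"
      proof (subst tail_iff)
        show "sorted_wrt (\<lambda>a b. tail_key n a < tail_key n b) (drop (n - r) (u @ arrange (tail_key n) X)) \<and>
          set (drop (n - r) (u @ arrange (tail_key n) X)) \<subseteq> {..Suc (n - r)} \<union> {n<..}"
          using lu X V(2) sorted_wrt_arrange[OF f inj_tail_key] by (auto simp: set_arrange[OF f])
      qed fact
      ultimately show ?case by (simp add: b inj_lists_def)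
    qed auto
    also have "\<dots> = (\<Sum>X\<in>?XX r. \<Sum>u\<in>inj_lists (n - r) (?Z - X). ?g u X)"
      by (rule sum.Sigma[symmetric]) (use finXX finZ in auto)
    also have "\<dots> = (\<Sum>X\<in>?XX r. t ^ card (X \<inter> {n<..}) * Wsum q t (n - r) (?Z - X))"
    proof (rule sum.cong[OF refl])
      fix X
      have "(\<Sum>u\<in>inj_lists (n - r) (?Z - X). ?g u X) =
        (\<Sum>u\<in>inj_lists (n - r) (?Z - X). t ^ card (X \<inter> {n<..}) * (wt q t u / qpoch q (n - r)))"
        by (rule sum.cong) (auto simp: inj_lists_def)
      then show "(\<Sum>u\<in>inj_lists (n - r) (?Z - X). ?g u X) = t ^ card (X \<inter> {n<..}) * Wsum q t (n - r) (?Z - X)"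
        by (simp add: Wsum_def sum_distrib_left sum_divide_distrib)
    qed
    finally show ?thesis .
  qed
  have "q ^ n * Wsum q t n ?Z = (\<Sum>xs\<in>?I. q ^ n * (wt q t xs / qpoch q n))"
    by (simp add: Wsum_def sum_distrib_left sum_divide_distrib)
  also have "\<dots> = (\<Sum>xs\<in>?I. \<Sum>r\<le>n. if ?tail xs r then (-1) ^ r * ?g (take (n - r) xs) (set (drop (n - r) xs)) else 0)"
    by (rule sum.cong[OF refl step])
  also have "\<dots> = (\<Sum>r\<le>n. \<Sum>xs\<in>?I. if ?tail xs r then (-1) ^ r * ?g (take (n - r) xs) (set (drop (n - r) xs)) else 0)"
    by (rule sum.swap)
  also have "\<dots> = (\<Sum>r\<le>n. (-1) ^ r * (\<Sum>X\<in>?XX r. t ^ card (X \<inter> {n<..}) * Wsum q t (n - r) (?Z - X)))"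
  proof (rule sum.cong[OF refl])
    fix r assume "r \<in> {..n}"
    then have r: "r \<le> n" by simp
    have "(\<Sum>xs\<in>?I. if ?tail xs r then (-1) ^ r * ?g (take (n - r) xs) (set (drop (n - r) xs)) else 0) =
      (\<Sum>xs\<in>{xs\<in>?I. ?tail xs r}. (-1) ^ r * ?g (take (n - r) xs) (set (drop (n - r) xs)))"
      by (rule sum.inter_filter[symmetric]) (use finZ in auto)
    also have "\<dots> = (-1) ^ r * (\<Sum>xs\<in>{xs\<in>?I. ?tail xs r}. ?g (take (n - r) xs) (set (drop (n - r) xs)))"
      by (rule sum_distrib_left[symmetric])
    finally show "(\<Sum>xs\<in>?I. if ?tail xs r then (-1) ^ r * ?g (take (n - r) xs) (set (drop (n - r) xs)) else 0) =
      (-1) ^ r * (\<Sum>X\<in>?XX r. t ^ card (X \<inter> {n<..}) * Wsum q t (n - r) (?Z - X))"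
      by (simp only: inner[OF r])
  qed
  finally show ?thesis .
qed

section \<open>Power series coefficients for the tail recursion\<close>

lemma fps_mult_compose_X_nth:
  fixes F P Y :: "real fps"
  shows "(F * (P oo (fps_X * Y))) $ m = (\<Sum>s\<le>m. P $ s * (F * Y ^ s) $ (m - s))"
proof -
  have XY: "((fps_X * Y) ^ s) $ j = (if j < s then 0 else (Y ^ s) $ (j - s))" for s j
    by (simp add: power_mult_distrib fps_X_power_mult_nth)
  have "(F * (P oo (fps_X * Y))) $ m = (\<Sum>i\<le>m. F $ (m - i) * (\<Sum>s\<le>i. P $ s * (Y ^ s) $ (i - s)))"
    unfolding mult.commute[of F] fps_mult_nth fps_compose_nth atLeast0AtMost
    by (intro sum.cong refl) (auto simp: XY mult.commute intro!: sum.cong)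
  also have "\<dots> = (\<Sum>i\<le>m. \<Sum>s\<le>i. P $ s * ((Y ^ s) $ (i - s) * F $ (m - (s + (i - s)))))"
    by (simp add: sum_distrib_left mult_ac)
  also have "\<dots> = (\<Sum>(s, j)\<in>{(s, j). s + j \<le> m}. P $ s * ((Y ^ s) $ j * F $ (m - (s + j))))"
    by (rule sum.triangle_reindex_eq[symmetric])
  also have "\<dots> = (\<Sum>s\<le>m. \<Sum>j\<le>m - s. P $ s * ((Y ^ s) $ j * F $ (m - (s + j))))"
  proof -
    have "{(s, j). s + j \<le> m} = Sigma {..m} (\<lambda>s. {..m - s})" by auto
    then show ?thesis by (simp add: sum.Sigma)
  qed
  also have "\<dots> = (\<Sum>s\<le>m. P $ s * (F * Y ^ s) $ (m - s))"
    by (simp add: mult.commute[of F] fps_mult_nth atLeast0AtMost sum_distrib_left diff_diff_add)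
  finally show ?thesis .
qed

text \<open>The quantity shared by both sides. For power series the two summands come from the terms
  1 and -X of \<open>1 - fps_X\<close> (\<open>fps_tail_coeff\<close>); for injections they come
  from sets of avoided values without and with \<open>Suc m\<close>
  (\<open>avoiding_sum_Suc\<close>).\<close>

definition tail_coeff :: "real fps \<Rightarrow> real fps \<Rightarrow> nat \<Rightarrow> nat \<Rightarrow> nat \<Rightarrow> real" where
  "tail_coeff R D b s m =
     real ((s + b) choose s) * (R * (D - 1) ^ s * D ^ b) $ m +
     (if s = 0 then 0 else real ((s + b - 1) choose (s - 1)) * (R * (D - 1) ^ (s - 1) * D ^ b) $ m)"

text \<open>\<open>K\<close> is the negative binomial series (1 + Y)^(-b-1) at Y = X (D - 1), whose
  coefficients are signed binomials.\<close>

lemma fps_tail_coeff: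
  fixes R D :: "real fps" and b :: nat
  defines "K \<equiv> inverse ((1 + fps_X) ^ Suc b) oo (fps_X * (D - 1))"
  shows "((1 - fps_X) * (R * D ^ b * K)) $ m = (\<Sum>s\<le>m. (-1) ^ s * tail_coeff R D b s (m - s))"
proof -
  let ?Y = "D - 1"
  let ?P = "inverse ((1 + fps_X :: real fps) ^ Suc b)"
  let ?G = "\<lambda>s. R * ?Y ^ s * D ^ b"
  have P: "?P $ s = (-1) ^ s * real ((s + b) choose s)" for s
  proof -
    have "1 + fps_X = 1 - fps_const (-1) * (fps_X :: real fps)"
      by (simp flip: fps_const_neg)
    then have "?P = inverse ((1 - fps_const (-1) * fps_X) ^ Suc b)" by (simp only:)
    also have "\<dots> = Abs_fps (\<lambda>k. of_nat ((Suc b + k - 1) choose k) * (-1) ^ k)"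
      by (rule one_minus_const_fps_X_neg_power') simp
    finally show ?thesis by (simp add: add.commute mult.commute)
  qed
  have 1: "(R * D ^ b * K) $ m = (\<Sum>s\<le>m. (-1) ^ s * (real ((s + b) choose s) * ?G s $ (m - s)))" for m
    unfolding K_def fps_mult_compose_X_nth P by (simp add: mult_ac)
  have "((1 - fps_X) * (R * D ^ b * K)) $ m = (R * D ^ b * K) $ m - (if m = 0 then 0 else (R * D ^ b * K) $ (m - 1))"
    by (simp add: left_diff_distrib)
  \<comment> \<open>Multiplication by X moves \<open>s\<close> to \<open>Suc s\<close>; the sign
    this produces cancels the minus of \<open>1 - fps_X\<close>.\<close>
  also have "(if m = 0 then 0 else (R * D ^ b * K) $ (m - 1)) =
    - (\<Sum>s\<le>m. (-1) ^ s * (if s = 0 then 0 else real ((s + b - 1) choose (s - 1)) * ?G (s - 1) $ (m - s)))"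
    by (cases m) (simp_all add: 1 sum.atMost_Suc_shift sum_negf del: sum.atMost_Suc)
  finally show ?thesis
    unfolding 1 tail_coeff_def by (simp add: distrib_left sum.distrib)
qed

lemma fps_binomial_power_nth:
  "((1 - fps_const t * fps_X) ^ b) $ j = real (b choose j) * (- t) ^ j" for t :: real
proof -
  have "((1 - fps_const t * fps_X) ^ b) = (\<Sum>k\<le>b. of_nat (b choose k) * (fps_const (- t) * fps_X) ^ k * 1 ^ (b - k))"
    by (subst binomial_ring[symmetric]) (simp add: fps_const_neg[symmetric] del: fps_const_neg)
  then have "((1 - fps_const t * fps_X) ^ b) $ j = (\<Sum>k\<le>b. real (b choose k) * (- t) ^ k * (if j = k then 1 else 0))"
    by (simp add: fps_sum_nth power_mult_distrib fps_const_power mult.assoc fps_of_nat[symmetric] del: fps_of_nat)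
  also have "\<dots> = real (b choose j) * (- t) ^ j"
    by (cases "j \<le> b") (simp_all add: if_distrib cong: if_cong)
  finally show ?thesis .
qed

section \<open>Solution of the tail recursion\<close>

context
  fixes q t :: real and R D :: "real fps"
  assumes q: "0 < q" "q < 1"
  assumes R0: "R $ 0 = 1"
  assumes feq: "(R oo (fps_const q * fps_X)) * (1 + fps_X * (fps_const t * (R - 1))) = R * (1 - fps_X)"
  assumes D_def: "D = 1 + fps_const t * (R - 1)"
begin

text \<open>\<open>D\<close> is affine in \<open>R\<close>, so it inherits a scaling equation with
  the same factor 1 + X (D - 1) as \<open>R\<close>. Consequently R D^b acquires exactly the power
  \<open>Suc b\<close> of this factor.\<close>

lemma D_scale:
  "(D oo (fps_const q * fps_X)) * (1 + fps_X * (D - 1)) = D * (1 - fps_const t * fps_X)"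
proof -
  have "(D oo (fps_const q * fps_X)) = 1 + fps_const t * ((R oo (fps_const q * fps_X)) - 1)"
    by (simp add: D_def fps_compose_add_distrib fps_compose_mult_distrib fps_compose_sub_distrib)
  moreover have expand_scaled: "(1 + T * (R' - 1)) * (1 + X * (1 + T * (R - 1) - 1)) =
      (1 - T) * (1 + X * (1 + T * (R - 1) - 1)) + T * (R' * (1 + X * (T * (R - 1))))" for T R' X :: "real fps"
    by (simp add: algebra_simps)
  moreover have collect_factors: "(1 - T) * (1 + X * (1 + T * (R - 1) - 1)) + T * (R * (1 - X)) = (1 + T * (R - 1)) * (1 - T * X)"
    for T X :: "real fps"
    by (simp add: algebra_simps)
  ultimately have "(D oo (fps_const q * fps_X)) * (1 + fps_X * (D - 1)) =
    (1 - fps_const t) * (1 + fps_X * (D - 1)) +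
      fps_const t * ((R oo (fps_const q * fps_X)) * (1 + fps_X * (fps_const t * (R - 1))))"
    by (simp only: D_def)
  also have "\<dots> = D * (1 - fps_const t * fps_X)"
    unfolding feq D_def by (rule collect_factors)
  finally show ?thesis .
qed

text \<open>Substituting qX turns R D^b into (1 - tX)^b (1 - X) R D^b (1 + X (D - 1))^(-b-1). In the
  comparison with injections, the index \<open>j\<close> from (1 - tX)^b counts the large values in
  the tail, each weighted by \<open>t\<close>, and \<open>r - j\<close> counts the small
  ones.\<close>

lemma RD_tail_expansion:
  "q ^ n * (R * D ^ b) $ n =
    (\<Sum>r\<le>n. (-1) ^ r * (\<Sum>j\<le>r. real (b choose j) * t ^ j * tail_coeff R D b (r - j) (n - r)))"
proof -
  let ?c = "fps_const q * fps_X"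
  let ?K = "inverse ((1 + fps_X) ^ Suc b) oo (fps_X * (D - 1))"
  let ?S = "(1 - fps_X) * (R * D ^ b * ?K)"
  \<comment> \<open>The inverse is taken before substituting X (D - 1), which has zero constant
    term, so composition respects products.\<close>
  have K: "(1 + fps_X * (D - 1)) ^ Suc b * ?K = 1"
  proof -
    have "(1 + fps_X * (D - 1)) ^ Suc b = ((1 + fps_X) ^ Suc b) oo (fps_X * (D - 1))"
      by (subst fps_compose_power[symmetric]) (simp_all add: fps_compose_add_distrib)
    then have "(1 + fps_X * (D - 1)) ^ Suc b * ?K = (((1 + fps_X) ^ Suc b * inverse ((1 + fps_X) ^ Suc b)) oo (fps_X * (D - 1)))"
      by (simp only: fps_compose_mult_distrib[where c = "fps_X * (D - 1)"] fps_X_mult_nth if_True simp_thms)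
    also have "(1 + fps_X) ^ Suc b * inverse ((1 + fps_X) ^ Suc b) = (1 :: real fps)"
      by (rule inverse_mult_eq_1') (simp add: fps_nth_power_0)
    finally show ?thesis by simp
  qed
  have "q ^ n * (R * D ^ b) $ n = ((R * D ^ b) oo ?c) $ n"
    by simp
  also have "((R * D ^ b) oo ?c) = (R oo ?c) * (D oo ?c) ^ b"
    by (simp add: fps_compose_mult_distrib fps_compose_power)
  also have "\<dots> = (R oo ?c) * (D oo ?c) ^ b * ((1 + fps_X * (D - 1)) ^ Suc b * ?K)"
    by (simp only: K mult_1_right)
  also have "\<dots> = ((R oo ?c) * (1 + fps_X * (D - 1))) * ((D oo ?c) * (1 + fps_X * (D - 1))) ^ b * ?K"
    by (simp add: power_mult_distrib mult_ac)
  also have "(R oo ?c) * (1 + fps_X * (D - 1)) = R * (1 - fps_X)"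
    using feq by (simp add: D_def)
  also have "R * (1 - fps_X) * ((D oo ?c) * (1 + fps_X * (D - 1))) ^ b * ?K = (1 - fps_const t * fps_X) ^ b * ?S"
    unfolding D_scale by (simp only: power_mult_distrib mult_ac)
  also have "\<dots> $ n = (\<Sum>j\<le>n. \<Sum>s\<le>n - j. real (b choose j) * (- t) ^ j * ((-1) ^ s * tail_coeff R D b s (n - (j + s))))"
    by (simp only: fps_mult_nth[of "(1 - fps_const t * fps_X) ^ b"] fps_tail_coeff fps_binomial_power_nth
        sum_distrib_left diff_diff_add atLeast0AtMost)
  also have "\<dots> = (\<Sum>(j, s)\<in>{(j, s). j + s \<le> n}. real (b choose j) * (- t) ^ j * ((-1) ^ s * tail_coeff R D b s (n - (j + s))))"
  proof -
    have "{(j, s). j + s \<le> n} = Sigma {..n} (\<lambda>j. {..n - j})" by auto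
    then show ?thesis by (simp add: sum.Sigma)
  qed
  also have "\<dots> = (\<Sum>r\<le>n. \<Sum>j\<le>r. real (b choose j) * (- t) ^ j * ((-1) ^ (r - j) * tail_coeff R D b (r - j) (n - (j + (r - j)))))"
    by (rule sum.triangle_reindex_eq)
  also have "\<dots> = (\<Sum>r\<le>n. (-1) ^ r * (\<Sum>j\<le>r. real (b choose j) * t ^ j * tail_coeff R D b (r - j) (n - r)))"
    unfolding sum_distrib_left
  proof (intro sum.cong refl)
    fix r j assume "r \<in> {..n}" "j \<in> {..r}"
    then have "(- t) ^ j * (-1) ^ (r - j) = (-1) ^ r * t ^ j"
      by (simp add: power_minus[of t] power_add[symmetric] mult.commute mult.left_commute)
    then show "real (b choose j) * (- t) ^ j * ((-1) ^ (r - j) * tail_coeff R D b (r - j) (n - (j + (r - j)))) =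
      (-1) ^ r * (real (b choose j) * t ^ j * tail_coeff R D b (r - j) (n - r))"
      using \<open>j \<in> {..r}\<close> by (simp add: mult_ac)
  qed
  finally show ?thesis .
qed

text \<open>Requiring a large value means allowing it minus forbidding it, and D^(c+1) - D^c = (D -
  1) D^c. Thus an allowed large value contributes \<open>D\<close> and a required one
  \<open>D - 1\<close>.\<close>

lemma hitting_sum:
  assumes H: "\<And>V. finite V \<Longrightarrow> V \<subseteq> {m<..} \<Longrightarrow> Wsum q t m ({1..m} \<union> V) = (R * D ^ card V) $ m"
    and "finite S" "finite V" "S \<inter> V = {}" "S \<union> V \<subseteq> {m<..}"
  shows "(\<Sum>u | u \<in> inj_lists m ({1..m} \<union> (S \<union> V)) \<and> S \<subseteq> set u. wt q t u) / qpoch q m =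
    (R * (D - 1) ^ card S * D ^ card V) $ m"
  using assms(2-5)
proof (induction S arbitrary: V rule: finite_induct)
  case empty
  then show ?case using H[of V] by (simp add: Wsum_def)
next
  case (insert x S)
  let ?A = "\<lambda>V. {u. u \<in> inj_lists m ({1..m} \<union> (S \<union> V)) \<and> S \<subseteq> set u}"
  have x: "x > m" "x \<notin> V" using insert by auto
  have "{u. u \<in> inj_lists m ({1..m} \<union> (insert x S \<union> V)) \<and> insert x S \<subseteq> set u} = ?A (insert x V) - ?A V"
  proof -
    define Z where "Z = {1..m} \<union> (S \<union> V)"
    have Z: "{1..m} \<union> (insert x S \<union> V) = insert x Z" "{1..m} \<union> (S \<union> insert x V) = insert x Z"
      by (simp_all add: Z_def insert_commute)
    have "x \<notin> Z" using x insert.hyps by (simp add: Z_def)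
    then show ?thesis unfolding Z Z_def[symmetric] inj_lists_def by blast
  qed
  moreover have "?A V \<subseteq> ?A (insert x V)" by (auto simp: inj_lists_def)
  moreover have fin: "finite (?A (insert x V))" using insert by simp
  ultimately have "(\<Sum>u | u \<in> inj_lists m ({1..m} \<union> (insert x S \<union> V)) \<and> insert x S \<subseteq> set u. wt q t u) =
    (\<Sum>u\<in>?A (insert x V). wt q t u) - (\<Sum>u\<in>?A V. wt q t u)"
    by (simp only: sum_diff)
  then have "(\<Sum>u | u \<in> inj_lists m ({1..m} \<union> (insert x S \<union> V)) \<and> insert x S \<subseteq> set u. wt q t u) / qpoch q m =
    (\<Sum>u\<in>?A (insert x V). wt q t u) / qpoch q m - (\<Sum>u\<in>?A V. wt q t u) / qpoch q m"
    by (simp only: diff_divide_distrib)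
  also have "\<dots> = (R * (D - 1) ^ card S * D ^ card (insert x V)) $ m - (R * (D - 1) ^ card S * D ^ card V) $ m"
    using insert.IH[of "insert x V"] insert.IH[of V] insert.prems insert.hyps by simp
  also have "\<dots> = (R * (D - 1) ^ card (insert x S) * D ^ card V) $ m"
    using insert x by (simp add: algebra_simps flip: fps_sub_nth)
  finally show ?case .
qed

text \<open>An injection on \<open>m\<close> positions misses as many values of
  \<open>{1..m}\<close> as it uses values of \<open>V\<close>. So sets of \<open>s\<close> missed
  small values can be traded for sets of \<open>s\<close> used large values, which
  \<open>hitting_sum\<close> evaluates.\<close>

lemma avoiding_sum:
  assumes H: "\<And>V. finite V \<Longrightarrow> V \<subseteq> {m<..} \<Longrightarrow> Wsum q t m ({1..m} \<union> V) = (R * D ^ card V) $ m"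
    and V: "finite V" "V \<subseteq> {m<..}"
  shows "(\<Sum>S | S \<subseteq> {1..m} \<and> card S = s. Wsum q t m ({1..m} \<union> V - S)) =
    real (card V choose s) * (R * (D - 1) ^ s * D ^ (card V - s)) $ m"
proof -
  let ?I = "inj_lists m ({1..m} \<union> V)"
  let ?SS = "{S. S \<subseteq> {1..m} \<and> card S = s}"
  let ?TT = "{T. T \<subseteq> V \<and> card T = s}"
  have fI: "finite ?I" using V by simp
  have fSS: "finite ?SS" by (rule finite_subset[of _ "Pow {1..m}"]) auto
  have fTT: "finite ?TT" by (rule finite_subset[of _ "Pow V"]) (use V in auto)
  have filter: "(\<Sum>x\<in>A. if P x then c else 0) = real (card {x \<in> A. P x}) * c" if "finite A" for A :: "nat set set" and P and c :: real
    using that by (simp flip: sum.inter_filter)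
  have cards: "card {S \<in> ?SS. set u \<inter> S = {}} = card {T \<in> ?TT. T \<subseteq> set u}" if u: "u \<in> ?I" for u
  proof -
    have u': "length u = m" "distinct u" "set u \<subseteq> {1..m} \<union> V" using u by (auto simp: inj_lists_def)
    have "set u - {1..m} = set u \<inter> V" using u' V(2) by fastforce
    then have "card (set u) = card (set u \<inter> {1..m}) + card (set u \<inter> V)"
      using card_Int_Diff[of "set u" "{1..m}"] by simp
    moreover have "m = card (set u \<inter> {1..m}) + card ({1..m} - set u)"
      using card_Int_Diff[of "{1..m}" "set u"] by (simp add: Int_commute)
    ultimately have "card ({1..m} - set u) = card (set u \<inter> V)" using u' by (simp add: distinct_card)
    moreover have "{S \<in> ?SS. set u \<inter> S = {}} = {S. S \<subseteq> {1..m} - set u \<and> card S = s}" by auto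
    moreover have "{T \<in> ?TT. T \<subseteq> set u} = {T. T \<subseteq> set u \<inter> V \<and> card T = s}" by auto
    ultimately show ?thesis
      by (simp only: n_subsets finite_Diff finite_atLeastAtMost finite_Int finite_set simp_thms)
  qed
  have "(\<Sum>S\<in>?SS. \<Sum>u\<in>inj_lists m ({1..m} \<union> V - S). wt q t u) =
    (\<Sum>S\<in>?SS. \<Sum>u\<in>?I. if set u \<inter> S = {} then wt q t u else 0)"
  proof (rule sum.cong[OF refl])
    fix S
    have "inj_lists m ({1..m} \<union> V - S) = {u \<in> ?I. set u \<inter> S = {}}" by (auto simp: inj_lists_def)
    then show "(\<Sum>u\<in>inj_lists m ({1..m} \<union> V - S). wt q t u) = (\<Sum>u\<in>?I. if set u \<inter> S = {} then wt q t u else 0)"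
      using fI by (simp only: sum.inter_filter)
  qed
  also have "\<dots> = (\<Sum>u\<in>?I. real (card {S \<in> ?SS. set u \<inter> S = {}}) * wt q t u)"
    by (subst sum.swap) (simp only: filter[OF fSS])
  also have "\<dots> = (\<Sum>u\<in>?I. real (card {T \<in> ?TT. T \<subseteq> set u}) * wt q t u)"
    by (rule sum.cong[OF refl]) (simp only: cards)
  also have "\<dots> = (\<Sum>T\<in>?TT. \<Sum>u\<in>?I. if T \<subseteq> set u then wt q t u else 0)"
    by (subst sum.swap) (simp only: filter[OF fTT])
  also have "\<dots> = (\<Sum>T\<in>?TT. \<Sum>u | u \<in> ?I \<and> T \<subseteq> set u. wt q t u)"
    using fI by (simp only: sum.inter_filter)
  finally have "(\<Sum>S\<in>?SS. Wsum q t m ({1..m} \<union> V - S)) =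
    (\<Sum>T\<in>?TT. (\<Sum>u | u \<in> ?I \<and> T \<subseteq> set u. wt q t u) / qpoch q m)"
    by (simp add: Wsum_def flip: sum_divide_distrib)
  also have "\<dots> = (\<Sum>T\<in>?TT. (R * (D - 1) ^ s * D ^ (card V - s)) $ m)"
  proof (rule sum.cong[OF refl])
    fix T assume T: "T \<in> ?TT"
    then have "finite T" "T \<union> (V - T) = V" using V finite_subset by auto
    then show "(\<Sum>u | u \<in> ?I \<and> T \<subseteq> set u. wt q t u) / qpoch q m = (R * (D - 1) ^ s * D ^ (card V - s)) $ m"
      using hitting_sum[OF H, of T "V - T"] T V by (simp add: card_Diff_subset)
  qed
  also have "\<dots> = real (card V choose s) * (R * (D - 1) ^ s * D ^ (card V - s)) $ m"
    using n_subsets[OF V(1)] by simp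
  finally show ?thesis .
qed

text \<open>\<open>Suc m\<close> is small for the tail, being its first position, but large for the
  \<open>m\<close> remaining positions. If it lies in \<open>S\<close> it is merely removed from
  \<open>V\<close>, and \<open>avoiding_sum\<close> applies with \<open>s - 1\<close>;
  \<open>V\<close> shrinks as well, so the exponent \<open>b\<close> of \<open>D\<close>
  stays.\<close>

lemma avoiding_sum_Suc:
  assumes H: "\<And>V. finite V \<Longrightarrow> V \<subseteq> {m<..} \<Longrightarrow> Wsum q t m ({1..m} \<union> V) = (R * D ^ card V) $ m"
    and V: "finite V" "V \<subseteq> {m<..}" "Suc m \<in> V" and c: "card V = s + b"
  shows "(\<Sum>S | S \<subseteq> {1..Suc m} \<and> card S = s. Wsum q t m ({1..m} \<union> V - S)) = tail_coeff R D b s m"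
proof -
  let ?f = "\<lambda>S. Wsum q t m ({1..m} \<union> V - S)"
  let ?A = "{S. S \<subseteq> {1..m} \<and> card S = s}"
  let ?B = "{S. S \<subseteq> {1..Suc m} \<and> card S = s \<and> Suc m \<in> S}"
  have fin: "finite S" if "S \<subseteq> {1..m}" for S using finite_subset[OF that] by simp
  have "{S. S \<subseteq> {1..Suc m} \<and> card S = s} = ?A \<union> ?B"
    by (auto simp: atLeastAtMostSuc_conv)
  moreover have "finite ?A" "finite ?B"
    by (rule finite_subset[of _ "Pow {1..Suc m}"]; auto)+
  moreover have "?A \<inter> ?B = {}" by auto
  ultimately have "(\<Sum>S | S \<subseteq> {1..Suc m} \<and> card S = s. ?f S) = (\<Sum>S\<in>?A. ?f S) + (\<Sum>S\<in>?B. ?f S)"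
    by (simp only: sum.union_disjoint)
  also have "(\<Sum>S\<in>?A. ?f S) = real ((s + b) choose s) * (R * (D - 1) ^ s * D ^ b) $ m"
    using avoiding_sum[OF H V(1,2), of s] c by simp
  also have "(\<Sum>S\<in>?B. ?f S) = (if s = 0 then 0 else real ((s + b - 1) choose (s - 1)) * (R * (D - 1) ^ (s - 1) * D ^ b) $ m)"
  proof (cases s)
    case 0
    have "S = {}" if "S \<subseteq> {1..Suc m}" "card S = 0" for S
      using that finite_subset[OF that(1)] by simp
    then have "?B = {}" using 0 by blast
    then show ?thesis using 0 by (simp only: sum.empty) simp
  next
    case (Suc s')
    let ?C = "{S. S \<subseteq> {1..m} \<and> card S = s'}"
    have "(\<Sum>S\<in>?B. ?f S) = (\<Sum>S\<in>?C. Wsum q t m ({1..m} \<union> (V - {Suc m}) - S))"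
    proof (rule sum.reindex_bij_witness[where i = "insert (Suc m)" and j = "\<lambda>S. S - {Suc m}"])
      fix S assume S: "S \<in> ?B"
      then show "insert (Suc m) (S - {Suc m}) = S" by auto
      have "finite S" using S finite_subset[of S "{1..Suc m}"] by auto
      then show "S - {Suc m} \<in> ?C" using S Suc by (auto simp: atLeastAtMostSuc_conv)
      have "{1..m} \<union> (V - {Suc m}) - (S - {Suc m}) = {1..m} \<union> V - S" using S by auto
      then show "Wsum q t m ({1..m} \<union> (V - {Suc m}) - (S - {Suc m})) = ?f S" by (simp only:)
    next
      fix S assume S: "S \<in> ?C"
      then have "Suc m \<notin> S" by auto
      then show "insert (Suc m) S - {Suc m} = S" by auto
      show "insert (Suc m) S \<in> ?B" using S Suc fin[of S] \<open>Suc m \<notin> S\<close> by auto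
    qed
    also have "\<dots> = real ((s' + b) choose s') * (R * (D - 1) ^ s' * D ^ b) $ m"
      using avoiding_sum[OF H, of "V - {Suc m}" s'] V c Suc by auto
    finally show ?thesis using Suc by simp
  qed
  finally show ?thesis by (simp add: tail_coeff_def)
qed

text \<open>
  Only \<open>V = {}\<close> is needed in the end. The sets \<open>V\<close> of extra large values close the
  recursion: deleting a decreasing tail from an injection leaves an injection on fewer positions
  whose unused small values have been replaced by large ones.
\<close>

theorem Wsum_eq_coeff:
  "finite V \<Longrightarrow> V \<subseteq> {n<..} \<Longrightarrow> Wsum q t n ({1..n} \<union> V) = (R * D ^ card V) $ n"
proof (induction n arbitrary: V rule: less_induct)
  case (less n)
  note V = less.prems
  let ?b = "card V"
  let ?g = "\<lambda>r. \<Sum>X | X \<subseteq> {1..Suc (n - r)} \<union> V \<and> card X = r.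
        t ^ card (X \<inter> {n<..}) * Wsum q t (n - r) ({1..n} \<union> V - X)"
  let ?h = "\<lambda>r. \<Sum>j\<le>r. real (?b choose j) * t ^ j * tail_coeff R D ?b (r - j) (n - r)"
  show ?case
  proof (cases "n = 0")
    case True
    have "inj_lists 0 V = {[]}" by (auto simp: inj_lists_def)
    then show ?thesis using True R0
      by (simp add: Wsum_def wt_def lexc_def D_def fps_nth_power_0)
  next
    case False
    have g: "?g r = ?h r" if r: "r \<in> {1..n}" for r
    proof -
      let ?m = "n - r"
      have m: "?m < n" "Suc ?m \<le> n" using r by auto
      \<comment> \<open>The tail set splits into its large part \<open>T\<close> and its small part
        \<open>S\<close>.\<close>
      let ?Q = "{(T, S). T \<subseteq> V \<and> S \<subseteq> {1..Suc ?m} \<and> card S + card T = r}"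
      have disj: "{1..Suc ?m} \<inter> V = {}" using V m by fastforce
      have "?g r = (\<Sum>(T, S)\<in>?Q. t ^ card T * Wsum q t ?m ({1..n} \<union> V - (S \<union> T)))"
      proof (rule sum.reindex_bij_witness[where i = "\<lambda>(T, S). S \<union> T" and j = "\<lambda>X. (X \<inter> V, X \<inter> {1..Suc ?m})"], goal_cases)
        case (1 X)
        then show ?case by auto
      next
        case (2 X)
        then have "X = (X \<inter> {1..Suc ?m}) \<union> (X \<inter> V)" by auto
        then have "card X = card (X \<inter> {1..Suc ?m}) + card (X \<inter> V)"
          using V(1) disj by (metis (no_types, lifting) card_Un_disjoint finite_Int finite_atLeastAtMost inf_assoc inf_bot_right inf_left_commute)
        then show ?case using 2 by simp
      next
        case (3 a)
        then show ?case using disj by (cases a) auto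
      next
        case (4 a)
        obtain T S where a: "a = (T, S)" by (cases a)
        with 4 have TS: "T \<subseteq> V" "S \<subseteq> {1..Suc ?m}" "card S + card T = r" by auto
        then have "card (S \<union> T) = r" using disj V(1) finite_subset[OF TS(1)] finite_subset[OF TS(2)]
          by (subst card_Un_disjoint) auto
        then show ?case using TS a by auto
      next
        case (5 X)
        have "X \<inter> {n<..} = X \<inter> V" using 5 V m by fastforce
        moreover have "X \<inter> {1..Suc ?m} \<union> X \<inter> V = X" using 5 by auto
        ultimately show ?case by simp
      qed
      also have "?Q = Sigma {T \<in> Pow V. card T \<le> r} (\<lambda>T. {S. S \<subseteq> {1..Suc ?m} \<and> card S = r - card T})"
        by auto
      also have "(\<Sum>(T, S)\<in>\<dots>. t ^ card T * Wsum q t ?m ({1..n} \<union> V - (S \<union> T))) =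
        (\<Sum>T\<in>{T \<in> Pow V. card T \<le> r}. \<Sum>S | S \<subseteq> {1..Suc ?m} \<and> card S = r - card T. t ^ card T * Wsum q t ?m ({1..n} \<union> V - (S \<union> T)))"
        by (rule sum.Sigma[symmetric]) (use V in auto)
      also have "\<dots> = (\<Sum>T\<in>{T \<in> Pow V. card T \<le> r}. t ^ card T * tail_coeff R D ?b (r - card T) ?m)"
      proof (rule sum.cong[OF refl])
        fix T assume T: "T \<in> {T \<in> Pow V. card T \<le> r}"
        let ?V = "{Suc ?m..n} \<union> (V - T)"
        have cV: "card ?V = (r - card T) + ?b"
        proof -
          have fT: "finite T" using T finite_subset[OF _ V(1)] by auto
          have "card ?V = card {Suc ?m..n} + card (V - T)"
            by (rule card_Un_disjoint) (use V in auto)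
          also have "card (V - T) = ?b - card T" using T fT by (simp add: card_Diff_subset)
          also have "card {Suc ?m..n} = r" using r by auto
          finally show ?thesis using T card_mono[OF V(1), of T] by auto
        qed
        have "(\<Sum>S | S \<subseteq> {1..Suc ?m} \<and> card S = r - card T. Wsum q t ?m ({1..?m} \<union> ?V - S)) = tail_coeff R D ?b (r - card T) ?m"
        proof (rule avoiding_sum_Suc)
          show "\<And>V. finite V \<Longrightarrow> V \<subseteq> {n - r<..} \<Longrightarrow> Wsum q t (n - r) ({1..n - r} \<union> V) = (R * D ^ card V) $ (n - r)"
            by (rule less.IH[OF m(1)])
        qed (use V m cV in auto)
        moreover have "{1..n} \<union> V - (S \<union> T) = {1..?m} \<union> ?V - S" for S
          using T V m by auto
        ultimately show "(\<Sum>S | S \<subseteq> {1..Suc ?m} \<and> card S = r - card T. t ^ card T * Wsum q t ?m ({1..n} \<union> V - (S \<union> T))) =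
          t ^ card T * tail_coeff R D ?b (r - card T) ?m"
          by (simp flip: sum_distrib_left)
      qed
      also have "\<dots> = (\<Sum>j\<le>r. \<Sum>T\<in>{T \<in> {T \<in> Pow V. card T \<le> r}. card T = j}. t ^ card T * tail_coeff R D ?b (r - card T) ?m)"
        by (rule sum.group[symmetric]) (use V in auto)
      also have "\<dots> = ?h r"
      proof (rule sum.cong[OF refl])
        fix j assume j: "j \<in> {..r}"
        then have "{T \<in> {T \<in> Pow V. card T \<le> r}. card T = j} = {T. T \<subseteq> V \<and> card T = j}" by auto
        then show "(\<Sum>T\<in>{T \<in> {T \<in> Pow V. card T \<le> r}. card T = j}. t ^ card T * tail_coeff R D ?b (r - card T) ?m) =
          real (?b choose j) * t ^ j * tail_coeff R D ?b (r - j) ?m"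
          by (simp add: n_subsets[OF V(1)])
      qed
      finally show ?thesis .
    qed
    have g0: "?g 0 = Wsum q t n ({1..n} \<union> V)"
    proof -
      have "{X. X \<subseteq> {1..Suc (n - 0)} \<union> V \<and> card X = 0} = {{}}"
      proof -
        have "finite X" if "X \<subseteq> {1..Suc n} \<union> V" for X using finite_subset[OF that] V by simp
        then show ?thesis by auto
      qed
      then show ?thesis by simp
    qed
    have h0: "?h 0 = (R * D ^ ?b) $ n" by (simp add: tail_coeff_def)
    have split: "(\<Sum>r\<le>n. f r) = f 0 + (\<Sum>r=1..n. f r)" for f :: "nat \<Rightarrow> real"
      by (simp add: sum.atLeast_Suc_atMost flip: atLeast0AtMost)
    have "q ^ n * Wsum q t n ({1..n} \<union> V) = Wsum q t n ({1..n} \<union> V) + (\<Sum>r=1..n. (-1) ^ r * ?h r)"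
      unfolding Wsum_tail_expansion[OF q V] split using g g0 by simp
    moreover have "q ^ n * (R * D ^ ?b) $ n = (R * D ^ ?b) $ n + (\<Sum>r=1..n. (-1) ^ r * ?h r)"
      unfolding RD_tail_expansion split using h0 by simp
    \<comment> \<open>The terms with \<open>r > 0\<close> agree, and each side contains its own
      unknown once more as the term \<open>r = 0\<close>.\<close>
    ultimately have "(1 - q ^ n) * Wsum q t n ({1..n} \<union> V) = (1 - q ^ n) * (R * D ^ ?b) $ n"
      by (simp only: left_diff_distrib mult_1_left)
    moreover have "1 - q ^ n \<noteq> 0" using pow_less_one[OF q, of n] False by simp
    ultimately show ?thesis using mult_left_cancel by blast
  qed
qed

end

section \<open>The q-gamma-expansion\<close>

lemma poly_eq_if_eq_on_infinite:
  fixes p r :: "'a::idom poly"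
  assumes "infinite S" "\<And>x. x \<in> S \<Longrightarrow> poly p x = poly r x"
  shows "p = r"
proof (rule ccontr)
  assume "p \<noteq> r"
  then have "finite {x. poly (p - r) x = 0}" by (intro poly_roots_finite) simp
  moreover have "S \<subseteq> {x. poly (p - r) x = 0}" using assms(2) by auto
  ultimately show False using assms(1) finite_subset by blast
qed

section \<open>List statistics as statistics of permutations\<close>

lemma tame_conv_nth:
  "tame xs \<longleftrightarrow> (\<forall>i. Suc i < length xs \<and> xs ! i > xs ! Suc i \<longrightarrow>
     Suc (Suc i) < length xs \<and> xs ! Suc i < xs ! Suc (Suc i))"
proof (induction xs rule: tame.induct)
  case (1 x y zs)
  have all_nat: "(\<forall>i. P i) \<longleftrightarrow> P 0 \<and> (\<forall>i. P (Suc i))" for P :: "nat \<Rightarrow> bool"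
    by (metis nat.exhaust)
  have "(\<forall>i. Suc i < length (x # y # zs) \<and> (x # y # zs) ! i > (x # y # zs) ! Suc i \<longrightarrow>
     Suc (Suc i) < length (x # y # zs) \<and> (x # y # zs) ! Suc i < (x # y # zs) ! Suc (Suc i)) \<longleftrightarrow>
     (x > y \<longrightarrow> zs \<noteq> [] \<and> y < hd zs) \<and> (\<forall>i. Suc i < length (y # zs) \<and> (y # zs) ! i > (y # zs) ! Suc i \<longrightarrow>
     Suc (Suc i) < length (y # zs) \<and> (y # zs) ! Suc i < (y # zs) ! Suc (Suc i))"
    by (subst all_nat) (auto simp: hd_conv_nth)
  then show ?case using 1 by simp
qed auto

lemma ldes_conv_card: "ldes xs = card {i. Suc i < length xs \<and> xs ! i > xs ! Suc i}"
proof (induction xs rule: ldes.induct)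
  case (1 x y zs)
  let ?A = "{i. Suc i < length (y # zs) \<and> (y # zs) ! i > (y # zs) ! Suc i}"
  have "{i. Suc i < length (x # y # zs) \<and> (x # y # zs) ! i > (x # y # zs) ! Suc i} =
    (if x > y then {0} else {}) \<union> Suc ` ?A" (is "?L = ?R")
  proof (rule set_eqI)
    fix i show "i \<in> ?L \<longleftrightarrow> i \<in> ?R" by (cases i) auto
  qed
  moreover have "finite ?A" by (rule finite_subset[of _ "{..length zs}"]) auto
  ultimately show ?case using 1 by (simp add: card_image)
qed auto

context
  fixes n :: nat and \<sigma> :: "nat \<Rightarrow> nat"
  assumes \<sigma>: "\<sigma> permutes {1..n}"
begin

lemma neighbours_neq: "\<sigma> i \<noteq> \<sigma> (Suc i)"
  by (simp add: inj_eq[OF permutes_inj[OF \<sigma>]])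

lemma DES_perm_list:
  "DES n \<sigma> = Suc ` {i. Suc i < length (map \<sigma> [1..<Suc n]) \<and> map \<sigma> [1..<Suc n] ! i > map \<sigma> [1..<Suc n] ! Suc i}"
    (is "_ = Suc ` ?A")
proof (rule set_eqI)
  fix i show "i \<in> DES n \<sigma> \<longleftrightarrow> i \<in> Suc ` ?A"
    by (cases i) (auto simp: DES_def)
qed

lemma ldes_perm_list: "ldes (map \<sigma> [1..<Suc n]) = card (DES n \<sigma>)"
  unfolding ldes_conv_card DES_perm_list by (simp only: card_image inj_Suc)

lemma tame_perm_list:
  "tame (map \<sigma> [1..<Suc n]) \<longleftrightarrow> (\<forall>i. \<not> (i \<in> DES n \<sigma> \<and> Suc i \<in> DES n \<sigma>)) \<and> n - 1 \<notin> DES n \<sigma>"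
proof -
  have "tame (map \<sigma> [1..<Suc n]) \<longleftrightarrow> (\<forall>i. Suc i < n \<and> \<sigma> (Suc i) > \<sigma> (Suc (Suc i)) \<longrightarrow>
     Suc (Suc i) < n \<and> \<sigma> (Suc (Suc i)) < \<sigma> (Suc (Suc (Suc i))))"
    unfolding tame_conv_nth by (intro iff_allI) auto
  also have "\<dots> \<longleftrightarrow> (\<forall>i. i \<in> DES n \<sigma> \<longrightarrow> Suc i < n \<and> Suc i \<notin> DES n \<sigma>)"
  proof safe
    fix i assume H: "\<forall>i. Suc i < n \<and> \<sigma> (Suc i) > \<sigma> (Suc (Suc i)) \<longrightarrow>
       Suc (Suc i) < n \<and> \<sigma> (Suc (Suc i)) < \<sigma> (Suc (Suc (Suc i)))" and i: "i \<in> DES n \<sigma>"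
    then obtain j where j: "i = Suc j" by (cases i) (auto simp: DES_def)
    then have "Suc j < n \<and> \<sigma> (Suc j) > \<sigma> (Suc (Suc j))" using i by (auto simp: DES_def)
    from H[rule_format, OF this] show "Suc i < n" "Suc i \<in> DES n \<sigma> \<Longrightarrow> False"
      by (auto simp: DES_def j)
  next
    fix i assume H: "\<forall>i. i \<in> DES n \<sigma> \<longrightarrow> Suc i < n \<and> Suc i \<notin> DES n \<sigma>"
      and i: "Suc i < n" "\<sigma> (Suc i) > \<sigma> (Suc (Suc i))"
    then have "Suc i \<in> DES n \<sigma>" by (auto simp: DES_def)
    from H[rule_format, OF this] show "Suc (Suc i) < n" "\<sigma> (Suc (Suc i)) < \<sigma> (Suc (Suc (Suc i)))"
      using neighbours_neq[of "Suc (Suc i)"] by (auto simp: DES_def)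
  qed
  also have "\<dots> \<longleftrightarrow> (\<forall>i. \<not> (i \<in> DES n \<sigma> \<and> Suc i \<in> DES n \<sigma>)) \<and> n - 1 \<notin> DES n \<sigma>"
  proof -
    have "Suc i < n" if "n - 1 \<notin> DES n \<sigma>" "i \<in> DES n \<sigma>" for i
      using that by (cases "i = n - 1") (auto simp: DES_def)
    moreover have "n - 1 \<in> DES n \<sigma> \<Longrightarrow> \<not> Suc (n - 1) < n" by (auto simp: DES_def)
    ultimately show ?thesis by blast
  qed
  finally show ?thesis .
qed

lemma linv_perm_list: "linv (map \<sigma> [1..<Suc n]) = inversion_number n \<sigma>"
  unfolding linv_conv_card inversion_number_def
proof (rule bij_betw_same_card[OF bij_betw_byWitness[where f = "\<lambda>(i, j). (Suc i, Suc j)" and f' = "\<lambda>(a, b). (a - 1, b - 1)"]])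
  let ?xs = "map \<sigma> [1..<Suc n]"
  let ?L = "{(i, j). i < j \<and> j < length ?xs \<and> ?xs ! j < ?xs ! i}"
  let ?R = "{(i, j). 1 \<le> i \<and> i < j \<and> j \<le> n \<and> \<sigma> j < \<sigma> i}"
  show "\<forall>a\<in>?L. (\<lambda>(a, b). (a - 1, b - 1)) ((\<lambda>(i, j). (Suc i, Suc j)) a) = a" by auto
  show "\<forall>a\<in>?R. (\<lambda>(i, j). (Suc i, Suc j)) ((\<lambda>(a, b). (a - 1, b - 1)) a) = a" by auto
  show "(\<lambda>(i, j). (Suc i, Suc j)) ` ?L \<subseteq> ?R" by auto
  show "(\<lambda>(a, b). (a - 1, b - 1)) ` ?R \<subseteq> ?L" by auto
qed

text \<open>Ranking the barred values lowest changes the descent indicator at \<open>i\<close> by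
  the difference of the excedance indicators at \<open>Suc i\<close> and \<open>i\<close>. Weighted
  by \<open>i\<close>, these differences telescope to the number of excedances.\<close>

lemma maj_bdesc:
  "maj n \<sigma> = dsum (bdesc (map \<sigma> [1..<Suc n])) n + exc n \<sigma>"
proof -
  let ?xs = "map \<sigma> [1..<Suc n]"
  let ?d = "\<lambda>i. \<sigma> i > \<sigma> (Suc i)"
  let ?e = "\<lambda>i. of_bool (\<sigma> i > i) :: nat"
  have pointwise: "of_bool (?d i) + ?e (Suc i) = of_bool (bdesc ?xs i) + ?e i" if i: "1 \<le> i" "i < n" for i
  proof -
    have "?xs ! (i - 1) = \<sigma> i" "?xs ! i = \<sigma> (Suc i)" using i by simp_all
    then show ?thesis using neighbours_neq[of i] by (auto simp: bdesc_def)
  qed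
  \<comment> \<open>Abel summation; the boundary term vanishes at the end because \<open>n\<close>
    is never an excedance.\<close>
  have partial: "dsum ?d (Suc m) + m * ?e (Suc m) = dsum (bdesc ?xs) (Suc m) + (\<Sum>i\<in>{1..m}. ?e i)" if "m < n" for m
    using that
  proof (induction m)
    case 0
    then show ?case by (simp add: dsum_Suc)
  next
    case (Suc m)
    have D: "dsum d (Suc (Suc m)) = dsum d (Suc m) + Suc m * of_bool (d (Suc m))" for d
      by (simp add: dsum_Suc[of d "Suc m"])
    have "Suc m * of_bool (?d (Suc m)) + Suc m * ?e (Suc (Suc m)) = Suc m * of_bool (bdesc ?xs (Suc m)) + Suc m * ?e (Suc m)"
      using pointwise[of "Suc m"] Suc.prems by (simp only: distrib_left[symmetric])
    moreover have "(\<Sum>i\<in>{1..Suc m}. ?e i) = (\<Sum>i\<in>{1..m}. ?e i) + ?e (Suc m)" by simp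
    moreover have "Suc m * ?e (Suc m) = m * ?e (Suc m) + ?e (Suc m)" by simp
    ultimately show ?case using Suc.IH Suc.prems unfolding D by linarith
  qed
  show ?thesis
  proof (cases n)
    case 0
    then show ?thesis by (simp add: maj_def exc_def DES_def)
  next
    case (Suc m)
    have "\<sigma> n \<in> {1..n}" using permutes_in_image[OF \<sigma>, of n] Suc by simp
    then have "?e (Suc m) = 0" using Suc by simp
    moreover have "maj n \<sigma> = dsum ?d n"
      unfolding maj_def dsum_def DES_def by (rule arg_cong[of _ _ "sum _"]) (auto simp: Suc)
    moreover have "exc n \<sigma> = (\<Sum>i\<in>{1..m}. ?e i)"
      by (simp add: exc_def Suc Int_def)
    ultimately show ?thesis using partial[of m] Suc by simp
  qed
qed

lemma lexc_perm_list: "lexc (map \<sigma> [1..<Suc n]) = exc n \<sigma>"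
proof -
  have n: "\<sigma> n \<le> n" using permutes_in_image[OF \<sigma>, of n] permutes_not_in[OF \<sigma>, of n] by (cases "n \<ge> 1") auto
  have "{i \<in> {1..n-1}. \<sigma> i > i} = Suc ` {p. p < length (map \<sigma> [1..<Suc n]) \<and> map \<sigma> [1..<Suc n] ! p > Suc p}" (is "?L = Suc ` ?R")
  proof (rule set_eqI)
    fix i
    show "i \<in> ?L \<longleftrightarrow> i \<in> Suc ` ?R"
    proof (cases i)
      case (Suc j)
      then have "i \<in> Suc ` ?R \<longleftrightarrow> j < n \<and> \<sigma> i > i" by auto
      then show ?thesis using n Suc by (cases "i = n") auto
    qed auto
  qed
  then show ?thesis unfolding exc_def lexc_def by (simp only: card_image inj_Suc)
qed

lemma wt_perm_list: "wt q t (map \<sigma> [1..<Suc n]) = q ^ (maj n \<sigma> - exc n \<sigma>) * t ^ exc n \<sigma>"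
  unfolding wt_def lexc_perm_list using maj_bdesc by simp

end

text \<open>The descent set and its shift by one are disjoint subsets of
  \<open>{1..n - 1}\<close>.\<close>

lemma card_DES_tame:
  assumes "\<forall>i. \<not> (i \<in> DES n \<sigma> \<and> Suc i \<in> DES n \<sigma>)" "n - 1 \<notin> DES n \<sigma>"
  shows "card (DES n \<sigma>) \<le> (n - 1) div 2"
proof -
  let ?D = "DES n \<sigma>"
  have fin: "finite ?D" by (simp add: DES_def)
  have "card (?D \<union> Suc ` ?D) = card ?D + card (Suc ` ?D)"
    by (rule card_Un_disjoint) (use assms fin in auto)
  moreover have "?D \<union> Suc ` ?D \<subseteq> {1..n - 1}"
  proof -
    have "i < n - 1" if "i \<in> ?D" for i using that assms(2) by (cases "i = n - 1") (auto simp: DES_def)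
    then show ?thesis by (fastforce simp: DES_def)
  qed
  then have "card (?D \<union> Suc ` ?D) \<le> n - 1" using card_mono[of "{1..n - 1}"] by fastforce
  ultimately show ?thesis by (simp add: card_image)
qed

lemma tame_sum_conv_gamma:
  "tame_sum q x {1..n} = (\<Sum>k\<le>(n - 1) div 2. x ^ k * poly (gamma_poly n k) q)"
proof -
  let ?T = "{\<sigma>. \<sigma> permutes {1..n} \<and> tame (map \<sigma> [1..<Suc n])}"
  have fin: "finite ?T" by (rule finite_subset[of _ "{\<sigma>. \<sigma> permutes {1..n}}"]) (auto simp: finite_permutations)
  have bij: "bij_betw (\<lambda>\<sigma>. map \<sigma> [1..<Suc n]) ?T (tame_lists {1..n})"
    using bij_betw_permutes_list[of n] by (auto simp: bij_betw_def tame_lists_def inj_on_def)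
  have "tame_sum q x {1..n} = (\<Sum>\<sigma>\<in>?T. q ^ linv (map \<sigma> [1..<Suc n]) * x ^ ldes (map \<sigma> [1..<Suc n]))"
    unfolding tame_sum_def by (rule sum.reindex_bij_betw[OF bij, symmetric])
  also have "\<dots> = (\<Sum>\<sigma>\<in>?T. q ^ inversion_number n \<sigma> * x ^ card (DES n \<sigma>))"
  proof (rule sum.cong[OF refl])
    fix \<sigma> assume "\<sigma> \<in> ?T"
    then have s: "\<sigma> permutes {1..n}" by blast
    show "q ^ linv (map \<sigma> [1..<Suc n]) * x ^ ldes (map \<sigma> [1..<Suc n]) = q ^ inversion_number n \<sigma> * x ^ card (DES n \<sigma>)"
      by (simp only: linv_perm_list[OF s] ldes_perm_list[OF s])
  qed
  also have "\<dots> = (\<Sum>k\<le>(n - 1) div 2. \<Sum>\<sigma>\<in>{\<sigma> \<in> ?T. card (DES n \<sigma>) = k}. q ^ inversion_number n \<sigma> * x ^ card (DES n \<sigma>))"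
  proof (rule sum.group[OF fin, symmetric])
    show "(\<lambda>\<sigma>. card (DES n \<sigma>)) ` ?T \<subseteq> {..(n - 1) div 2}"
    proof (rule image_subsetI)
      fix \<sigma> assume "\<sigma> \<in> ?T"
      then have "\<sigma> permutes {1..n}" "tame (map \<sigma> [1..<Suc n])" by blast+
      then show "card (DES n \<sigma>) \<in> {..(n - 1) div 2}"
        unfolding atMost_iff tame_perm_list[OF \<open>\<sigma> permutes {1..n}\<close>] by (intro card_DES_tame) blast+
    qed
  qed simp
  also have "\<dots> = (\<Sum>k\<le>(n - 1) div 2. x ^ k * poly (gamma_poly n k) q)"
  proof (rule sum.cong[OF refl])
    fix k
    have "{\<sigma> \<in> ?T. card (DES n \<sigma>) = k} = Gamma_set n k"
      unfolding Gamma_set_conv_DES using tame_perm_list by blast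
    moreover have "card (DES n \<sigma>) = k" if "\<sigma> \<in> Gamma_set n k" for \<sigma>
      using that by (simp add: Gamma_set_conv_DES)
    ultimately show "(\<Sum>\<sigma>\<in>{\<sigma> \<in> ?T. card (DES n \<sigma>) = k}. q ^ inversion_number n \<sigma> * x ^ card (DES n \<sigma>)) =
      x ^ k * poly (gamma_poly n k) q"
      by (simp add: gamma_poly_def poly_sum poly_monom sum_distrib_left mult.commute)
  qed
  finally show ?thesis .
qed

section \<open>The functional equation from the recursion\<close>

definition gamma_side :: "real \<Rightarrow> real \<Rightarrow> nat \<Rightarrow> real" where
  "gamma_side q t n = (if n = 0 then 1 else (1 + t) ^ (n - 1) * tame_sum q (t / (1 + t)\<^sup>2) {1..n})"

text \<open>With x = t/(1 + t)^2 the exponents fit: (1 + t)^n x = t (1 + t)^(k-1) (1 + t)^(n-k-1),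
  which clears the denominators in \<open>tame_sum_Suc\<close>.\<close>

lemma gamma_side_Suc:
  assumes q: "0 < q" "q < 1" and t: "0 < t" and n: "0 < n"
  shows "gamma_side q t (Suc n) = (1 + t) * gamma_side q t n +
    t * (\<Sum>k\<in>{1..<n}. qbin q n k * q ^ k * (gamma_side q t k * gamma_side q t (n - k)))"
proof -
  let ?x = "t / (1 + t)\<^sup>2"
  let ?T = "\<lambda>k. tame_sum q ?x {1..k}"
  have "gamma_side q t (Suc n) = (1 + t) ^ n * ?T n + (1 + t) ^ n * ?x * (\<Sum>k\<in>{1..<n}. qbin q n k * q ^ k * (?T k * ?T (n - k)))"
  proof -
    have "gamma_side q t (Suc n) = (1 + t) ^ n * ?T (Suc n)" by (simp add: gamma_side_def)
    then show ?thesis by (simp only: tame_sum_Suc[OF q] distrib_left mult.assoc)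
  qed
  also have "(1 + t) ^ n * ?T n = (1 + t) * gamma_side q t n"
    using n by (cases n) (auto simp: gamma_side_def)
  also have "(1 + t) ^ n * ?x * (\<Sum>k\<in>{1..<n}. qbin q n k * q ^ k * (?T k * ?T (n - k))) =
    t * (\<Sum>k\<in>{1..<n}. qbin q n k * q ^ k * (gamma_side q t k * gamma_side q t (n - k)))"
    unfolding sum_distrib_left
  proof (rule sum.cong[OF refl])
    fix k assume k: "k \<in> {1..<n}"
    then have "1 \<le> k" "k < n" by auto
    then have "n = Suc (Suc ((k - 1) + (n - k - 1)))" by arith
    then have "(1 + t) ^ n = (1 + t)\<^sup>2 * ((1 + t) ^ (k - 1) * (1 + t) ^ (n - k - 1))"
      by (metis mult.assoc power2_eq_square power_Suc power_add)
    then have "(1 + t) ^ n * ?x = t * ((1 + t) ^ (k - 1) * (1 + t) ^ (n - k - 1))" using t by simp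
    then show "(1 + t) ^ n * ?x * (qbin q n k * q ^ k * (?T k * ?T (n - k))) =
      t * (qbin q n k * q ^ k * (gamma_side q t k * gamma_side q t (n - k)))"
      using k by (simp add: gamma_side_def)
  qed
  finally show ?thesis .
qed

definition gamma_series :: "real \<Rightarrow> real \<Rightarrow> real fps" where
  "gamma_series q t = Abs_fps (\<lambda>n. gamma_side q t n / qpoch q n)"

text \<open>Dividing the recursion by \<open>qpoch q n\<close> turns the q-binomial sum into a
  convolution, and the factor \<open>q ^ k\<close> into the substitution of qX in one of its
  factors.\<close>

lemma gamma_series_functional_equation:
  assumes q: "0 < q" "q < 1" and t: "0 < t"
  defines "R \<equiv> gamma_series q t"
  shows "(R oo (fps_const q * fps_X)) * (1 + fps_X * (fps_const t * (R - 1))) = R * (1 - fps_X)"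
proof (rule fps_ext)
  fix n
  let ?R' = "R oo (fps_const q * fps_X)"
  have nz: "qpoch q m \<noteq> 0" for m using qpoch_pos[OF q, of m] by simp
  have R: "R $ m = gamma_side q t m / qpoch q m" for m by (simp add: R_def gamma_series_def)
  have R0: "R $ 0 = 1" by (simp add: R gamma_side_def)
  have T1: "gamma_side q t (Suc 0) = 1"
    using tame_sum_Suc[OF q, of _ 0] by (simp add: gamma_side_def)
  have L: "?R' * (1 + fps_X * (fps_const t * (R - 1))) = ?R' + fps_X * (fps_const t * (?R' * (R - 1)))"
    by (simp add: algebra_simps)
  show "(?R' * (1 + fps_X * (fps_const t * (R - 1)))) $ n = (R * (1 - fps_X)) $ n"
  proof (cases n)
    case 0
    then show ?thesis by (simp add: R0)
  next
    case (Suc m)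
    have key: "gamma_side q t (Suc m) / qpoch q m = R $ m + t * (?R' * (R - 1)) $ m"
    proof (cases m)
      case 0
      then show ?thesis by (simp add: T1 R0)
    next
      case (Suc j)
      have "(?R' * (R - 1)) $ m = (\<Sum>i=0..m. q ^ i * R $ i * (R - 1) $ (m - i))"
        by (simp add: fps_mult_nth)
      \<comment> \<open>The index 0 yields \<open>R $ m\<close> and accounts for the
        \<open>t\<close> in the factor 1 + t; the index \<open>m\<close> drops out since
        \<open>R - 1\<close> has no constant term.\<close>
      also have "\<dots> = R $ m + (\<Sum>i\<in>{1..<m}. q ^ i * R $ i * R $ (m - i))"
      proof -
        have "{0..m} = insert 0 (insert m {1..<m})" using Suc by auto
        then show ?thesis using Suc R0 by (simp add: sum.insert)
      qed
      finally have e: "(?R' * (R - 1)) $ m = R $ m + (\<Sum>i\<in>{1..<m}. q ^ i * R $ i * R $ (m - i))" .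
      have s: "(\<Sum>k\<in>{1..<m}. qbin q m k * q ^ k * (gamma_side q t k * gamma_side q t (m - k))) / qpoch q m =
        (\<Sum>i\<in>{1..<m}. q ^ i * R $ i * R $ (m - i))"
        unfolding sum_divide_distrib by (rule sum.cong[OF refl]) (simp add: qbin_def R nz)
      have "gamma_side q t (Suc m) / qpoch q m = (1 + t) * (gamma_side q t m / qpoch q m) +
        t * ((\<Sum>k\<in>{1..<m}. qbin q m k * q ^ k * (gamma_side q t k * gamma_side q t (m - k))) / qpoch q m)"
        using gamma_side_Suc[OF q t, of m] Suc by (simp add: add_divide_distrib)
      then show ?thesis unfolding e s R[symmetric] by (simp add: algebra_simps)
    qed
    \<comment> \<open>The left side is the coefficient of R - R(qX).\<close>
    have "(1 - q ^ Suc m) * R $ Suc m = gamma_side q t (Suc m) / qpoch q m"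
      using nz[of "Suc m"] nz[of m] by (simp add: R qpoch_Suc)
    then have "q ^ Suc m * R $ Suc m + t * (?R' * (R - 1)) $ m = R $ Suc m - R $ m"
      unfolding key by (simp add: algebra_simps)
    then show ?thesis unfolding L Suc by (simp add: right_diff_distrib)
  qed
qed

lemma poly_q_eulerian:
  assumes q: "0 < q" "q < 1" and t: "0 < t"
  shows "poly (poly (q_eulerian n) [:t:]) q = gamma_side q t n"
proof -
  let ?R = "gamma_series q t"
  have R0: "?R $ 0 = 1" by (simp add: gamma_series_def gamma_side_def)
  have nz: "qpoch q n \<noteq> 0" using qpoch_pos[OF q, of n] by simp
  have ip: "inj_lists n {1..n} = permutations_of_set {1..n}"
  proof (intro set_eqI iffI)
    fix xs assume "xs \<in> inj_lists n {1..n}"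
    then have xs: "length xs = n" "distinct xs" "set xs \<subseteq> {1..n}" by (auto simp: inj_lists_def)
    have "set xs = {1..n}" by (rule card_subset_eq) (use xs in \<open>auto simp: distinct_card\<close>)
    then show "xs \<in> permutations_of_set {1..n}" using xs by (simp add: permutations_of_set_def)
  next
    fix xs assume "xs \<in> permutations_of_set {1..n}"
    then have xs: "distinct xs" "set xs = {1..n}" by (auto simp: permutations_of_set_def)
    then have "length xs = n" using distinct_card by fastforce
    then show "xs \<in> inj_lists n {1..n}" using xs by (simp add: inj_lists_def)
  qed
  have "poly (poly (q_eulerian n) [:t:]) q = (\<Sum>\<sigma> | \<sigma> permutes {1..n}. q ^ (maj n \<sigma> - exc n \<sigma>) * t ^ exc n \<sigma>)"
    by (simp add: q_eulerian_def poly_sum poly_monom poly_power)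
  also have "\<dots> = (\<Sum>\<sigma> | \<sigma> permutes {1..n}. wt q t (map \<sigma> [1..<Suc n]))"
    by (intro sum.cong refl wt_perm_list[symmetric]) (simp only: mem_Collect_eq)
  also have "\<dots> = (\<Sum>xs\<in>permutations_of_set {1..n}. wt q t xs)"
    by (rule sum.reindex_bij_betw[OF bij_betw_permutes_list])
  also have "\<dots> = Wsum q t n ({1..n} \<union> {}) * qpoch q n"
    unfolding Un_empty_right Wsum_def ip using nz by simp
  also have "\<dots> = ?R $ n * qpoch q n"
    using Wsum_eq_coeff[OF q R0 gamma_series_functional_equation[OF q t] refl, of "{}" n] by simp
  also have "\<dots> = gamma_side q t n"
    using nz by (simp add: gamma_series_def)
  finally show ?thesis .
qed

lemma q_positive_gamma_poly: "q_positive (gamma_poly n k)"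
  by (simp add: q_positive_def gamma_poly_def coeff_sum sum_nonneg)

theorem theorem4p4:
  fixes n :: nat
  assumes "n \<ge> 1"
  shows "(\<forall>k. gamma_poly n k = (\<Sum>\<sigma>\<in>Gamma_set n k. monom 1 (maj n (inv \<sigma>)))) \<and>
    q_eulerian n =
      (\<Sum>k \<le> (n - 1) div 2.
         smult (gamma_poly n k) (monom 1 k * [:1, 1:] ^ (n - 1 - 2 * k))) \<and>
    q_gamma_positive (q_eulerian n)"
proof -
  have inf: "infinite {0<..<1::real}" by (simp add: infinite_Ioo)
  have 1: "gamma_poly n k = (\<Sum>\<sigma>\<in>Gamma_set n k. monom 1 (maj n (inv \<sigma>)))" for k
  proof (rule poly_eq_if_eq_on_infinite[OF inf])
    fix q :: real assume "q \<in> {0<..<1}"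
    then show "poly (gamma_poly n k) q = poly (\<Sum>\<sigma>\<in>Gamma_set n k. monom 1 (maj n (inv \<sigma>))) q"
      using sum_Gamma_inv_eq_imaj[of q n k] by (simp add: gamma_poly_def poly_sum poly_monom)
  qed
  let ?rhs = "\<Sum>k \<le> (n - 1) div 2. smult (gamma_poly n k) (monom 1 k * [:1, 1:] ^ (n - 1 - 2 * k))"
  have 2: "q_eulerian n = ?rhs"
  proof (rule poly_eq_if_eq_on_infinite)
    \<comment> \<open>The coefficients in \<open>t\<close> are polynomials in \<open>q\<close>, so
      the evaluation points for \<open>t\<close> are constant polynomials, infinitely many in the
      domain \<open>real poly\<close>.\<close>
    have "inj_on (\<lambda>t::real. [:t:]) {0<..<1}" by (simp add: inj_on_def)
    then show "infinite ((\<lambda>t::real. [:t:]) ` {0<..<1})" using inf finite_imageD by blast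
    fix p :: "real poly" assume "p \<in> (\<lambda>t. [:t:]) ` {0<..<1}"
    then obtain t where p: "p = [:t:]" and t: "0 < t" by auto
    show "poly (q_eulerian n) p = poly ?rhs p"
    proof (rule poly_eq_if_eq_on_infinite[OF inf])
      fix q :: real assume "q \<in> {0<..<1}"
      then have q: "0 < q" "q < 1" by auto
      have gs: "gamma_side q t n = (1 + t) ^ (n - 1) * tame_sum q (t / (1 + t)\<^sup>2) {1..n}"
        using assms by (simp add: gamma_side_def)
      have "poly (poly (q_eulerian n) p) q = (\<Sum>k\<le>(n - 1) div 2. (1 + t) ^ (n - 1) * (t / (1 + t)\<^sup>2) ^ k * poly (gamma_poly n k) q)"
        unfolding p poly_q_eulerian[OF q t] gs tame_sum_conv_gamma by (simp only: sum_distrib_left mult.assoc)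
      also have "\<dots> = (\<Sum>k\<le>(n - 1) div 2. poly (gamma_poly n k) q * (t ^ k * (1 + t) ^ (n - 1 - 2 * k)))"
      proof (rule sum.cong[OF refl])
        fix k assume "k \<in> {..(n - 1) div 2}"
        \<comment> \<open>The bound on \<open>k\<close> keeps the subtraction exact, so the
          denominator (1 + t)^(2k) cancels.\<close>
        then have "n - 1 = (n - 1 - 2 * k) + 2 * k" by auto
        then have "(1 + t) ^ (n - 1) = (1 + t) ^ (n - 1 - 2 * k) * ((1 + t)\<^sup>2) ^ k"
          by (metis power_add power_mult)
        then show "(1 + t) ^ (n - 1) * (t / (1 + t)\<^sup>2) ^ k * poly (gamma_poly n k) q =
          poly (gamma_poly n k) q * (t ^ k * (1 + t) ^ (n - 1 - 2 * k))"
          using t by (simp add: power_divide)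
      qed
      also have "\<dots> = poly (poly ?rhs p) q"
        by (simp add: p poly_sum poly_monom poly_power)
      finally show "poly (poly (q_eulerian n) p) q = poly (poly ?rhs p) q" .
    qed
  qed
  have "q_gamma_positive (q_eulerian n)"
    unfolding q_gamma_positive_def using 2 q_positive_gamma_poly by blast
  with 1 2 show ?thesis by blast
qed

end
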